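(* For every $c\in\mathbb N$ there is a randomized polynomial-time algorithm that, given a (directed) graph $G$ and (access to) an invariant automorphism sampler $S$ for $G$, constructs, with error probability at most $1/|G|^c$, a non-discrete partition $\pi$ of $V(G)$ such that (1) $\pi$ is finer than or as fine as the orbit partition of $V(G)$ under $\mathrm{Aut}(G)$, and (2) $\pi$ is invariant under $\mathrm{Aut}(G)$, i.e. $\psi(\pi)=\pi$ for all $\psi\in\mathrm{Aut}(G)$. The algorithm also provides a set of certificates $\Phi=\{\varphi_1,\ldots,\varphi_m\}\subseteq\mathrm{Aut}(G)$ such that for every pair of vertices $v,v'\in V(G)$ lying in the same class of $\pi$ there is some $\varphi_i$ with $\varphi_i(v)=v'$.
   Context: $|G|$ denotes the number of vertices of $G$. A partition is discrete if all its parts are singletons. A sampler over a finite set $M$ is a probability measure $\Pr_S$ on $M$ from which elements can be drawn independently. An invariant automorphism sampler for a graph $G$ is a sampler $S$ over $\mathrm{Aut}(G)\setminus\{\mathrm{id}\}$ such that $\Pr_S(\psi^{-1}\circ\varphi\circ\psi)=\Pr_S(\varphi)$ for all $\varphi\in\mathrm{Aut}(G)\setminus\{\mathrm{id}\}$ and all $\psi\in\mathrm{Aut}(G)$ (in particular $G$ has a non-trivial automorphism). *)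

theory Defs
  imports
    "HOL-Probability.Probability"
    "HOL-Combinatorics.Permutations"
    "HOL-Computational_Algebra.Polynomial"
    "Graph_Theory.Pair_Digraph"
begin

section \<open>Automorphisms and invariant samplers\<close>

text \<open>
  Automorphisms act on the vertex set only; as total functions they are normalised to be the
  identity outside of it, so that distinct functions are distinct automorphisms.
\<close>

definition Aut :: "'a pair_pre_digraph \<Rightarrow> ('a \<Rightarrow> 'a) set" where
  "Aut G = {\<psi>. \<psi> permutes pverts G \<and>
     (\<forall>u\<in>pverts G. \<forall>v\<in>pverts G. (\<psi> u, \<psi> v) \<in> parcs G \<longleftrightarrow> (u, v) \<in> parcs G)}"

definition orbit_partition :: "'a pair_pre_digraph \<Rightarrow> 'a set set" where
  "orbit_partition G = (\<lambda>v. (\<lambda>\<psi>. \<psi> v) ` Aut G) ` pverts G"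

definition discrete_partition :: "'a set set \<Rightarrow> bool" where
  "discrete_partition \<pi> \<longleftrightarrow> (\<forall>P\<in>\<pi>. is_singleton P)"

definition sampler_over :: "'b set \<Rightarrow> 'b pmf \<Rightarrow> bool" where
  "sampler_over M S \<longleftrightarrow> finite M \<and> set_pmf S \<subseteq> M"

definition invariant_automorphism_sampler :: "'a pair_pre_digraph \<Rightarrow> ('a \<Rightarrow> 'a) pmf \<Rightarrow> bool" where
  "invariant_automorphism_sampler G S \<longleftrightarrow>
     sampler_over (Aut G - {id}) S \<and>
     (\<forall>\<phi>\<in>Aut G - {id}. \<forall>\<psi>\<in>Aut G. pmf S (inv \<psi> \<circ> \<phi> \<circ> \<psi>) = pmf S \<phi>)"


section \<open>Randomized random-access programs with a sampling oracle\<close>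

text \<open>
  A structured random-access machine whose cells hold natural numbers.  Every step has unit cost.
  Addition and truncated subtraction are the only arithmetic operations, hence after
  \<open>t\<close> steps all numbers have bit length linear in \<open>t\<close> and the logarithm of the input
  size, and only linearly many cells have been changed: polynomial time on this machine coincides
  with polynomial time on Turing machines.  (Unit-cost multiplication would destroy this.)

  Scalar variables and two-dimensional arrays are named by natural numbers.  The instruction
  \<open>Sample\<close> is the oracle call: it draws a fresh map from the sampler, which the
  program can afterwards only query pointwise, by \<open>Drawn\<close>, until the next call.
  \<open>Flip\<close> is a fair coin toss.
\<close>

datatype expr =
    Const nat
  | Var nat
  | Elem nat expr expr
  | Drawn expr
  | Plus expr expr
  | Minus expr expr

datatype com =
    Skip
  | Assign nat expr
  | Update nat expr expr expr
  | Flip nat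
  | Sample
  | Seq com com
  | Cond expr com com
  | While expr com

record state =
  vars :: "nat \<Rightarrow> nat"
  arrays :: "nat \<Rightarrow> nat \<Rightarrow> nat \<Rightarrow> nat"
  drawn :: "nat \<Rightarrow> nat"

primrec eval_expr :: "expr \<Rightarrow> state \<Rightarrow> nat" where
  "eval_expr (Const k) s = k"
| "eval_expr (Var x) s = vars s x"
| "eval_expr (Elem a e1 e2) s = arrays s a (eval_expr e1 s) (eval_expr e2 s)"
| "eval_expr (Drawn e) s = drawn s (eval_expr e s)"
| "eval_expr (Plus e1 e2) s = eval_expr e1 s + eval_expr e2 s"
| "eval_expr (Minus e1 e2) s = eval_expr e1 s - eval_expr e2 s"

definition set_var :: "nat \<Rightarrow> nat \<Rightarrow> state \<Rightarrow> state" where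
  "set_var x k s = s\<lparr>vars := (vars s)(x := k)\<rparr>"

definition set_elem :: "nat \<Rightarrow> nat \<Rightarrow> nat \<Rightarrow> nat \<Rightarrow> state \<Rightarrow> state" where
  "set_elem a i j k s =
     s\<lparr>arrays := (arrays s)(a := (arrays s a)(i := (arrays s a i)(j := k)))\<rparr>"

text \<open>
  A configuration consists of the stack of commands still to be executed and the current state;
  it is halted iff the stack is empty.  A guard is true iff its value is nonzero.
\<close>

type_synonym config = "com list \<times> state"

fun step :: "(nat \<Rightarrow> nat) pmf \<Rightarrow> config \<Rightarrow> config pmf" where
  "step S ([], s) = return_pmf ([], s)"
| "step S (Skip # k, s) = return_pmf (k, s)"
| "step S (Assign x e # k, s) = return_pmf (k, set_var x (eval_expr e s) s)"
| "step S (Update a e1 e2 e # k, s) =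
     return_pmf (k, set_elem a (eval_expr e1 s) (eval_expr e2 s) (eval_expr e s) s)"
| "step S (Flip x # k, s) =
     map_pmf (\<lambda>b. (k, set_var x (of_bool b) s)) (bernoulli_pmf (1/2))"
| "step S (Sample # k, s) = map_pmf (\<lambda>\<phi>. (k, s\<lparr>drawn := \<phi>\<rparr>)) S"
| "step S (Seq c1 c2 # k, s) = return_pmf (c1 # c2 # k, s)"
| "step S (Cond e c1 c2 # k, s) =
     return_pmf ((if eval_expr e s \<noteq> 0 then c1 else c2) # k, s)"
| "step S (While e c # k, s) =
     return_pmf (if eval_expr e s \<noteq> 0 then c # While e c # k else k, s)"

primrec run :: "(nat \<Rightarrow> nat) pmf \<Rightarrow> nat \<Rightarrow> config \<Rightarrow> config pmf" where
  "run S 0 cfg = return_pmf cfg"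
| "run S (Suc t) cfg = bind_pmf (step S cfg) (run S t)"

definition halted :: "config \<Rightarrow> bool" where
  "halted cfg \<longleftrightarrow> fst cfg = []"


section \<open>Input and output conventions\<close>

text \<open>
  The vertices of an input graph of order \<open>n\<close> are the numbers below \<open>n\<close>.  Initially variable 0
  holds \<open>n\<close>, array 0 holds the adjacency matrix, and everything else is 0.

  On halting, row 0 of array 1 holds a class label for every vertex, variable 1 holds the
  number \<open>m\<close> of certificates, and row \<open>k < m\<close> of array 2 holds the table of values of the
  certificate with index \<open>k\<close>.
\<close>

definition input_graph :: "nat pair_pre_digraph \<Rightarrow> bool" where
  "input_graph G \<longleftrightarrow> pair_fin_digraph G \<and> pverts G = {..<card (pverts G)}"

definition init_state :: "nat pair_pre_digraph \<Rightarrow> state" where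
  "init_state G =
     \<lparr>vars = (\<lambda>x. if x = 0 then card (pverts G) else 0),
      arrays = (\<lambda>a u v. if a = 0 \<and> (u, v) \<in> parcs G then 1 else 0),
      drawn = (\<lambda>_. 0)\<rparr>"

definition output_partition :: "nat set \<Rightarrow> state \<Rightarrow> nat set set" where
  "output_partition V s = (\<lambda>v. {w\<in>V. arrays s 1 0 w = arrays s 1 0 v}) ` V"

definition output_certificate_set :: "nat set \<Rightarrow> state \<Rightarrow> (nat \<Rightarrow> nat) set" where
  "output_certificate_set V s =
     (\<lambda>k i. if i \<in> V then arrays s 2 k i else i) ` {..<vars s 1}"

definition correct_output ::
    "'a pair_pre_digraph \<Rightarrow> 'a set set \<Rightarrow> ('a \<Rightarrow> 'a) set \<Rightarrow> bool" where
  "correct_output G \<pi> \<Phi> \<longleftrightarrow>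
     partition_on (pverts G) \<pi> \<and> \<not> discrete_partition \<pi> \<and>
     refines (pverts G) \<pi> (orbit_partition G) \<and>
     (\<forall>\<psi>\<in>Aut G. (`) \<psi> ` \<pi> = \<pi>) \<and>
     finite \<Phi> \<and> \<Phi> \<subseteq> Aut G \<and>
     (\<forall>P\<in>\<pi>. \<forall>v\<in>P. \<forall>v'\<in>P. \<exists>\<phi>\<in>\<Phi>. \<phi> v = v')"

end

theory Submission
  imports Defs "HOL-Combinatorics.Cycles"
begin

text \<open>
  For an invariant sampler, the probability \<open>p(v, w)\<close> that a sample maps \<open>v\<close> to \<open>w\<close> is
  constant on the orbits of pairs.  Draw \<open>N = n ^ (c + 14)\<close> samples and count how often \<open>v\<close> is
  mapped to \<open>w\<close>; by Hoeffding's inequality all counts are within \<open>D / 2\<close> of \<open>N p(v, w)\<close>, where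
  \<open>D = n ^ (c + 9)\<close>, except with probability \<open>n ^ -c\<close>.  There are \<open>n ^ 2\<close> counts, so one of the
  \<open>n ^ 3\<close> intervals \<open>[i D, (i + 1) D)\<close> contains none of them.  The relation "count at least
  \<open>(i + 1) D\<close>" then only depends on \<open>p\<close> and is invariant.  Its transitive closure is automatically
  symmetric, because its pairs are realised by automorphisms of finite order, and its classes are
  the required partition.  It is not discrete: every sample moves a vertex, so some pair
  \<open>v \<noteq> w\<close> has count at least \<open>N / n ^ 2 = n ^ 3 D\<close>.  Certificates are carried along
  in Warshall's closure algorithm by composing samples.

  Running time is handled by a loop language in which every loop runs over the vertices: its
  programs have a polynomial cost and a functional semantics relative to the list of samples.
\<close>

section \<open>A loop language over the vertices\<close>

datatype prog =
    PSkip
  | PAssign nat expr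
  | PUpdate nat expr expr expr
  | PSample
  | PSeq prog prog
  | PIf expr prog prog
  | PFor nat prog

text \<open>The loop guard relies on variable 0 holding n and on truncated subtraction: n - x is
  nonzero exactly while x < n.\<close>

primrec compile :: "prog \<Rightarrow> com" where
  "compile PSkip = Skip"
| "compile (PAssign x e) = Assign x e"
| "compile (PUpdate a e1 e2 e) = Update a e1 e2 e"
| "compile PSample = Sample"
| "compile (PSeq p q) = Seq (compile p) (compile q)"
| "compile (PIf e p q) = Cond e (compile p) (compile q)"
| "compile (PFor x p) = Seq (Assign x (Const 0))
     (While (Minus (Var 0) (Var x)) (Seq (compile p) (Assign x (Plus (Var x) (Const 1)))))"

type_synonym sstate = "(nat \<Rightarrow> nat) list \<times> state"

text \<open>The state is paired with the list of samples still to be drawn.\<close>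

primrec sem :: "prog \<Rightarrow> sstate \<Rightarrow> sstate" where
  "sem PSkip = (\<lambda>\<sigma>. \<sigma>)"
| "sem (PAssign x e) = (\<lambda>(xs, s). (xs, set_var x (eval_expr e s) s))"
| "sem (PUpdate a e1 e2 e) =
     (\<lambda>(xs, s). (xs, set_elem a (eval_expr e1 s) (eval_expr e2 s) (eval_expr e s) s))"
| "sem PSample = (\<lambda>(xs, s). (tl xs, s\<lparr>drawn := hd xs\<rparr>))"
| "sem (PSeq p q) = (\<lambda>\<sigma>. sem q (sem p \<sigma>))"
| "sem (PIf e p q) = (\<lambda>\<sigma>. if eval_expr e (snd \<sigma>) \<noteq> 0 then sem p \<sigma> else sem q \<sigma>)"
| "sem (PFor x p) = (\<lambda>(xs, s).
     ((\<lambda>\<sigma>. apsnd (\<lambda>t. set_var x (vars t x + 1) t) (sem p \<sigma>)) ^^ vars s 0) (xs, set_var x 0 s))"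

text \<open>The value 0 for a conditional is correct under \<open>wf_prog\<close>, whose branches
  draw nothing; so the number of draws depends on n alone.\<close>

primrec samples :: "nat \<Rightarrow> prog \<Rightarrow> nat" where
  "samples n PSkip = 0"
| "samples n (PAssign x e) = 0"
| "samples n (PUpdate a e1 e2 e) = 0"
| "samples n PSample = 1"
| "samples n (PSeq p q) = samples n p + samples n q"
| "samples n (PIf e p q) = 0"
| "samples n (PFor x p) = n * samples n p"

text \<open>An upper bound on machine steps: a conditional is charged for both branches. In a loop,
  the outer 3 pays for \<open>Seq\<close>, initialisation and the last test, the inner 3 for test,
  \<open>Seq\<close> and increment in each round.\<close>

primrec cost :: "nat \<Rightarrow> prog \<Rightarrow> nat" where
  "cost n PSkip = 1"
| "cost n (PAssign x e) = 1"
| "cost n (PUpdate a e1 e2 e) = 1"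
| "cost n PSample = 1"
| "cost n (PSeq p q) = 1 + cost n p + cost n q"
| "cost n (PIf e p q) = 1 + cost n p + cost n q"
| "cost n (PFor x p) = 3 + n * (3 + cost n p)"

primrec writes :: "prog \<Rightarrow> nat set" where
  "writes PSkip = {}"
| "writes (PAssign x e) = {x}"
| "writes (PUpdate a e1 e2 e) = {}"
| "writes PSample = {}"
| "writes (PSeq p q) = writes p \<union> writes q"
| "writes (PIf e p q) = writes p \<union> writes q"
| "writes (PFor x p) = insert x (writes p)"

text \<open>Protects what loops rely on: variable 0 keeps n and a body never writes its own counter,
  so every loop makes exactly n rounds.\<close>

primrec wf_prog :: "prog \<Rightarrow> bool" where
  "wf_prog PSkip \<longleftrightarrow> True"
| "wf_prog (PAssign x e) \<longleftrightarrow> x \<noteq> 0"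
| "wf_prog (PUpdate a e1 e2 e) \<longleftrightarrow> True"
| "wf_prog PSample \<longleftrightarrow> True"
| "wf_prog (PSeq p q) \<longleftrightarrow> wf_prog p \<and> wf_prog q"
| "wf_prog (PIf e p q) \<longleftrightarrow>
     wf_prog p \<and> wf_prog q \<and> (\<forall>n. samples n p = 0 \<and> samples n q = 0)"
| "wf_prog (PFor x p) \<longleftrightarrow> wf_prog p \<and> x \<noteq> 0 \<and> x \<notin> writes p"

section \<open>Frame and splitting properties of the functional semantics\<close>

lemma vars_set_var [simp]: "vars (set_var x k s) = (vars s)(x := k)"
  and arrays_set_var [simp]: "arrays (set_var x k s) = arrays s"
  and drawn_set_var [simp]: "drawn (set_var x k s) = drawn s"
  and vars_set_elem [simp]: "vars (set_elem a i j k s) = vars s"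
  and arrays_set_elem [simp]:
    "arrays (set_elem a i j k s) = (arrays s)(a := (arrays s a)(i := (arrays s a i)(j := k)))"
  and drawn_set_elem [simp]: "drawn (set_elem a i j k s) = drawn s"
  by (simp_all add: set_var_def set_elem_def)

lemma wf_prog_writes: "wf_prog p \<Longrightarrow> 0 \<notin> writes p"
  by (induction p) auto

lemma vars_sem:
  assumes "y \<notin> writes p"
  shows "vars (snd (sem p \<sigma>)) y = vars (snd \<sigma>) y"
  using assms
proof (induction p arbitrary: \<sigma>)
  case (PFor x p)
  define f where "f = (\<lambda>\<sigma>. apsnd (\<lambda>t. set_var x (vars t x + 1) t) (sem p \<sigma>))"
  have "vars (snd ((f ^^ j) \<sigma>)) y = vars (snd \<sigma>) y" for j \<sigma>
    by (induction j) (use PFor in \<open>auto simp: f_def\<close>)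
  then show ?case using PFor.prems by (cases \<sigma>) (auto simp: f_def)
qed (auto split: prod.splits)

lemma vars_sem_0: "wf_prog p \<Longrightarrow> vars (snd (sem p \<sigma>)) 0 = vars (snd \<sigma>) 0"
  by (simp add: vars_sem wf_prog_writes)

text \<open>A well-formed program consumes exactly its prescribed number of samples from the front
  and never looks further. This separates the draws of consecutive program pieces.\<close>

lemma sem_append:
  assumes "wf_prog p" and "length xs = samples (vars s 0) p"
  shows "sem p (xs @ ys, s) = (ys, snd (sem p (xs, s)))"
  using assms
proof (induction p arbitrary: xs ys s)
  case PSample
  then show ?case by (cases xs) auto
next
  case (PSeq p q)
  define us where "us = take (samples (vars s 0) p) xs"
  define vs where "vs = drop (samples (vars s 0) p) xs"
  have xs: "xs = us @ vs" and us: "length us = samples (vars s 0) p"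
    and vs: "length vs = samples (vars s 0) q"
    using PSeq.prems by (auto simp: us_def vs_def)
  have wf: "wf_prog p" "wf_prog q" using PSeq.prems by auto
  have "vars (snd (sem p (us, s))) 0 = vars s 0" using vars_sem_0 wf by simp
  then show ?case
    using PSeq.IH(1)[OF wf(1) us, of "vs @ ys"] PSeq.IH(1)[OF wf(1) us, of vs]
      PSeq.IH(2)[OF wf(2), of vs "snd (sem p (us, s))"] vs xs by simp
next
  case (PIf e p q)
  have "xs = []" using PIf.prems by simp
  then show ?case using PIf.IH(1)[of "[]" s ys] PIf.IH(2)[of "[]" s ys] PIf.prems by simp
next
  case (PFor x p)
  define f where "f = (\<lambda>\<sigma>. apsnd (\<lambda>t. set_var x (vars t x + 1) t) (sem p \<sigma>))"
  have wf: "wf_prog p" "x \<noteq> 0" using PFor.prems by auto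
  have f: "f (us @ vs, s) = (vs, snd (f (us, s)))" if "length us = samples (vars s 0) p" for us vs s
    using PFor.IH[OF wf(1) that] by (simp add: f_def)
  have f0: "vars (snd (f (us, s))) 0 = vars s 0" for us s
    using vars_sem_0[OF wf(1)] wf(2) by (simp add: f_def)
  \<comment> \<open>The first round takes its samples from the front of the list, so the induction
    peels off the innermost application of \<open>f\<close>, by
    \<open>funpow_Suc_right\<close>.\<close>
  have "(f ^^ j) (us @ vs, s) = (vs, snd ((f ^^ j) (us, s)))"
    if "length us = j * samples (vars s 0) p" for j us vs s
    using that
  proof (induction j arbitrary: us s)
    case (Suc j)
    define u where "u = take (samples (vars s 0) p) us"
    define u' where "u' = drop (samples (vars s 0) p) us"
    have us: "us = u @ u'" "length u = samples (vars s 0) p" "length u' = j * samples (vars s 0) p"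
      using Suc.prems by (auto simp: u_def u'_def)
    have e1: "f (us @ vs, s) = (u' @ vs, snd (f (u, s)))" using f[OF us(2), of "u' @ vs"] us by simp
    have e2: "f (us, s) = (u', snd (f (u, s)))" using f[OF us(2), of u'] us by simp
    show ?case
      using Suc.IH[of u' "snd (f (u, s))"] us(3) f0 by (simp add: funpow_Suc_right e1 e2 del: funpow.simps)
  qed auto
  from this[of xs "vars s 0" "set_var x 0 s" ys] show ?case
    using PFor.prems by (simp add: f_def)
qed auto

section \<open>Distribution and running time of compiled programs\<close>

text \<open>
  Quantifying over all later times makes commands whose running time depends on the samples
  composable.
\<close>

definition runs_to :: "(nat \<Rightarrow> nat) pmf \<Rightarrow> nat \<Rightarrow> config \<Rightarrow> config pmf \<Rightarrow> bool" where
  "runs_to S T cfg D \<longleftrightarrow> (\<forall>t\<ge>T. run S t cfg = D)"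

lemma runs_to_mono: "runs_to S T cfg D \<Longrightarrow> T \<le> T' \<Longrightarrow> runs_to S T' cfg D"
  by (auto simp: runs_to_def)

lemma runs_to_step:
  assumes "\<And>cfg'. cfg' \<in> set_pmf (step S cfg) \<Longrightarrow> runs_to S T cfg' (D cfg')"
  shows "runs_to S (Suc T) cfg (bind_pmf (step S cfg) D)"
  unfolding runs_to_def
proof (intro allI impI)
  fix t assume "Suc T \<le> t"
  then obtain t' where t: "t = Suc t'" "T \<le> t'" by (cases t) auto
  show "run S t cfg = bind_pmf (step S cfg) D"
    using assms t by (auto simp: runs_to_def intro!: bind_pmf_cong)
qed

lemma runs_to_det_step:
  assumes "step S cfg = return_pmf cfg'" and "runs_to S T cfg' D"
  shows "runs_to S (Suc T) cfg D"
  using runs_to_step[of S cfg T "\<lambda>_. D"] assms by (simp add: bind_return_pmf)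

lemma bind_replicate_add:
  "bind_pmf (replicate_pmf (m + m') S) D =
   bind_pmf (replicate_pmf m S) (\<lambda>xs. bind_pmf (replicate_pmf m' S) (\<lambda>ys. D (xs @ ys)))"
  by (simp add: replicate_pmf_distrib bind_assoc_pmf bind_return_pmf)

lemma set_replicate_pmf_append:
  "xs \<in> set_pmf (replicate_pmf m S) \<Longrightarrow> ys \<in> set_pmf (replicate_pmf m' S) \<Longrightarrow>
   xs @ ys \<in> set_pmf (replicate_pmf (m + m') S)"
  by (auto simp: set_replicate_pmf)

text \<open>Continuation form: \<open>k\<close> is the rest of the stack and \<open>D xs\<close> its
  final distribution after samples \<open>xs\<close>. The draws made during the run are thereby
  moved to the front, as one list of independent samples.\<close>

lemma runs_to_compile:
  assumes "wf_prog p" and "vars s 0 = n"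
    and "\<And>xs. xs \<in> set_pmf (replicate_pmf (samples n p) S) \<Longrightarrow>
           runs_to S T (k, snd (sem p (xs, s))) (D xs)"
  shows "runs_to S (cost n p + T) (compile p # k, s) (bind_pmf (replicate_pmf (samples n p) S) D)"
  using assms
proof (induction p arbitrary: s T k D)
  case PSkip
  then show ?case by (auto simp: bind_return_pmf intro: runs_to_det_step)
next
  case (PAssign x e)
  then show ?case by (auto simp: bind_return_pmf intro: runs_to_det_step)
next
  case (PUpdate a e1 e2 e)
  then show ?case by (auto simp: bind_return_pmf intro: runs_to_det_step)
next
  case PSample
  \<comment> \<open>The continuation must be indexed by the successor configuration; the sample is
    read back from its \<open>drawn\<close> component.\<close>
  have "runs_to S (Suc T) (Sample # k, s)
      (bind_pmf (step S (Sample # k, s)) (\<lambda>cfg. D [drawn (snd cfg)]))"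
  proof (rule runs_to_step)
    fix cfg assume "cfg \<in> set_pmf (step S (Sample # k, s))"
    then obtain \<phi> where "\<phi> \<in> set_pmf S" "cfg = (k, s\<lparr>drawn := \<phi>\<rparr>)" by auto
    then show "runs_to S T cfg (D [drawn (snd cfg)])"
      using PSample.prems(3)[of "[\<phi>]"] by (simp add: set_replicate_pmf)
  qed
  then show ?case by (simp add: bind_map_pmf bind_assoc_pmf bind_return_pmf)
next
  case (PSeq p q)
  have wf: "wf_prog p" "wf_prog q" using PSeq.prems by auto
  have "runs_to S (cost n p + (cost n q + T)) (compile p # compile q # k, s)
      (bind_pmf (replicate_pmf (samples n p) S)
        (\<lambda>xs. bind_pmf (replicate_pmf (samples n q) S) (\<lambda>ys. D (xs @ ys))))"
  proof (rule PSeq.IH(1)[OF wf(1) PSeq.prems(2)])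
    fix xs assume xs: "xs \<in> set_pmf (replicate_pmf (samples n p) S)"
    have len: "length xs = samples (vars s 0) p" using xs PSeq.prems by (auto simp: set_replicate_pmf)
    have v0: "vars (snd (sem p (xs, s))) 0 = n" using vars_sem_0 wf PSeq.prems by simp
    show "runs_to S (cost n q + T) (compile q # k, snd (sem p (xs, s)))
        (bind_pmf (replicate_pmf (samples n q) S) (\<lambda>ys. D (xs @ ys)))"
    proof (rule PSeq.IH(2)[OF wf(2) v0])
      fix ys assume ys: "ys \<in> set_pmf (replicate_pmf (samples n q) S)"
      show "runs_to S T (k, snd (sem q (ys, snd (sem p (xs, s))))) (D (xs @ ys))"
        using PSeq.prems(3)[of "xs @ ys"] set_replicate_pmf_append[OF xs ys]
          sem_append[OF wf(1) len, of ys] by simp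
    qed
  qed
  then have "runs_to S (Suc (cost n p + (cost n q + T))) (compile (PSeq p q) # k, s)
      (bind_pmf (replicate_pmf (samples n (PSeq p q)) S) D)"
    by (intro runs_to_det_step[where cfg' = "(compile p # compile q # k, s)"])
      (auto simp: bind_replicate_add)
  then show ?case by (simp add: add.assoc)
next
  case (PIf e p q)
  have wf: "wf_prog p" "wf_prog q" and 0: "samples n p = 0" "samples n q = 0"
    using PIf.prems by auto
  have "runs_to S (cost n p + cost n q + T) ((if eval_expr e s \<noteq> 0 then compile p else compile q) # k, s) (D [])"
  proof (cases "eval_expr e s = 0")
    case True
    then show ?thesis using PIf.prems(3)[of "[]"] PIf.IH(2)[OF wf(2) PIf.prems(2), of T k D] 0
      by (auto simp: bind_return_pmf intro: runs_to_mono)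
  next
    case False
    then show ?thesis using PIf.prems(3)[of "[]"] PIf.IH(1)[OF wf(1) PIf.prems(2), of T k D] 0
      by (auto simp: bind_return_pmf intro: runs_to_mono)
  qed
  then show ?case by (auto simp: bind_return_pmf intro: runs_to_det_step)
next
  case (PFor x p)
  define f where "f = (\<lambda>\<sigma>. apsnd (\<lambda>t. set_var x (vars t x + 1) t) (sem p \<sigma>))"
  define W where "W = While (Minus (Var 0) (Var x)) (Seq (compile p) (Assign x (Plus (Var x) (Const 1))))"
  have wf: "wf_prog p" "x \<noteq> 0" "x \<notin> writes p" using PFor.prems by auto
  \<comment> \<open>Here \<open>j\<close> counts the remaining rounds, so the counter holds
    \<open>n - j\<close>; \<open>s\<close> and \<open>D\<close> are arbitrary because each round
    changes both.\<close>
  have loop: "runs_to S (1 + j * (3 + cost n p) + T) (W # k, s)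
      (bind_pmf (replicate_pmf (j * samples n p) S) D)"
    if "j \<le> n" "vars s 0 = n" "vars s x = n - j"
      "\<And>xs. xs \<in> set_pmf (replicate_pmf (j * samples n p) S) \<Longrightarrow>
         runs_to S T (k, snd ((f ^^ j) (xs, s))) (D xs)" for j s D
    using that
  proof (induction j arbitrary: s D)
    case 0
    then show ?case
      by (auto simp: W_def bind_return_pmf intro: runs_to_det_step)
  next
    case (Suc j)
    let ?Inc = "Assign x (Plus (Var x) (Const 1))"
    have "runs_to S (cost n p + (2 + j * (3 + cost n p) + T)) (compile p # ?Inc # W # k, s)
      (bind_pmf (replicate_pmf (samples n p) S)
        (\<lambda>xs. bind_pmf (replicate_pmf (j * samples n p) S) (\<lambda>ys. D (xs @ ys))))"
    proof (rule PFor.IH[OF wf(1) Suc.prems(2)])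
      fix xs assume xs: "xs \<in> set_pmf (replicate_pmf (samples n p) S)"
      define t where "t = snd (sem p (xs, s))"
      define t' where "t' = set_var x (vars t x + 1) t"
      have len: "length xs = samples (vars s 0) p" using xs Suc.prems by (auto simp: set_replicate_pmf)
      have t: "vars t 0 = n" "vars t x = n - Suc j"
        using vars_sem_0 vars_sem wf Suc.prems by (auto simp: t_def)
      have "runs_to S (1 + j * (3 + cost n p) + T) (W # k, t')
        (bind_pmf (replicate_pmf (j * samples n p) S) (\<lambda>ys. D (xs @ ys)))"
      proof (rule Suc.IH)
        show "j \<le> n" "vars t' 0 = n" "vars t' x = n - j"
          using Suc.prems t wf by (auto simp: t'_def)
        fix ys assume ys: "ys \<in> set_pmf (replicate_pmf (j * samples n p) S)"
        have "f (xs @ ys, s) = (ys, t')"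
          using sem_append[OF wf(1) len, of ys] by (simp add: f_def t_def t'_def)
        then have "(f ^^ Suc j) (xs @ ys, s) = (f ^^ j) (ys, t')"
          by (simp add: funpow_Suc_right del: funpow.simps)
        then show "runs_to S T (k, snd ((f ^^ j) (ys, t'))) (D (xs @ ys))"
          using Suc.prems(4)[of "xs @ ys"] set_replicate_pmf_append[OF xs ys] by simp
      qed
      then show "runs_to S (2 + j * (3 + cost n p) + T) (?Inc # W # k, snd (sem p (xs, s)))
          (bind_pmf (replicate_pmf (j * samples n p) S) (\<lambda>ys. D (xs @ ys)))"
        using runs_to_det_step[of S "(?Inc # W # k, t)" "(W # k, t')"] by (auto simp: t'_def t_def)
    qed
    then have "runs_to S (Suc (cost n p + (2 + j * (3 + cost n p) + T)))
        (Seq (compile p) ?Inc # W # k, s) (bind_pmf (replicate_pmf (Suc j * samples n p) S) D)"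
      by (intro runs_to_det_step[where cfg' = "(compile p # ?Inc # W # k, s)"])
        (auto simp: bind_replicate_add)
    then have "runs_to S (Suc (Suc (cost n p + (2 + j * (3 + cost n p) + T))))
        (W # k, s) (bind_pmf (replicate_pmf (Suc j * samples n p) S) D)"
    proof (rule runs_to_det_step[rotated])
      show "step S (W # k, s) = return_pmf (Seq (compile p) ?Inc # W # k, s)"
        using Suc.prems by (simp add: W_def)
    qed
    then show ?case by (rule runs_to_mono) (simp add: algebra_simps)
  qed
  have "runs_to S (1 + n * (3 + cost n p) + T) (W # k, set_var x 0 s)
      (bind_pmf (replicate_pmf (n * samples n p) S) D)"
    using PFor.prems wf by (intro loop) (auto simp: f_def)
  then have "runs_to S (Suc (1 + n * (3 + cost n p) + T)) (Assign x (Const 0) # W # k, s)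
      (bind_pmf (replicate_pmf (n * samples n p) S) D)"
    by (auto intro: runs_to_det_step)
  then have "runs_to S (Suc (Suc (1 + n * (3 + cost n p) + T))) (Seq (Assign x (Const 0)) W # k, s)
      (bind_pmf (replicate_pmf (n * samples n p) S) D)"
    by (rule runs_to_det_step[rotated]) simp
  then have "runs_to S (cost n (PFor x p) + T) (Seq (Assign x (Const 0)) W # k, s)
      (bind_pmf (replicate_pmf (n * samples n p) S) D)"
    by (rule runs_to_mono) simp
  then show ?case by (simp add: W_def)
qed

text \<open>Halting is certain within the cost bound, and the final state is a function of a list of
  independent samples; all later probabilities are computed on such lists.\<close>

lemma run_compile:
  assumes "wf_prog p" and "vars s 0 = n" and "cost n p \<le> t"
  shows "run S t ([compile p], s) =
    map_pmf (\<lambda>xs. ([], snd (sem p (xs, s)))) (replicate_pmf (samples n p) S)"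
proof -
  \<comment> \<open>An empty stack is stationary, so the continuation is a point distribution with
    time bound 0.\<close>
  have "run S t ([], s') = return_pmf ([], s')" for t s'
    by (induction t) (auto simp: bind_return_pmf)
  then have "runs_to S (cost n p + 0) ([compile p], s)
      (bind_pmf (replicate_pmf (samples n p) S) (\<lambda>xs. return_pmf ([], snd (sem p (xs, s)))))"
    by (intro runs_to_compile assms) (auto simp: runs_to_def)
  then show ?thesis using assms(3) by (simp add: runs_to_def map_pmf_def)
qed

lemma cost_poly: "\<exists>q :: nat poly. \<forall>n. cost n p = poly q n"
proof (induction p)
  case (PSeq p1 p2)
  then obtain q1 q2 where "\<forall>n. cost n p1 = poly q1 n" "\<forall>n. cost n p2 = poly q2 n" by blast
  then show ?case by (intro exI[of _ "1 + q1 + q2"]) simp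
next
  case (PIf e p1 p2)
  then obtain q1 q2 where "\<forall>n. cost n p1 = poly q1 n" "\<forall>n. cost n p2 = poly q2 n" by blast
  then show ?case by (intro exI[of _ "1 + q1 + q2"]) simp
next
  case (PFor x p)
  then obtain q where "\<forall>n. cost n p = poly q n" by blast
  then show ?case by (intro exI[of _ "[:3:] + [:0, 1:] * ([:3:] + q)"]) simp
qed (auto intro: exI[of _ 1])

section \<open>Hoare logic\<close>

text \<open>Variable 0 holding n is built into both sides of a triple, which keeps the loop bound
  fixed. The list argument of an assertion contains the samples not yet drawn.\<close>

definition hoare :: "nat \<Rightarrow> ((nat \<Rightarrow> nat) list \<Rightarrow> state \<Rightarrow> bool) \<Rightarrow> prog \<Rightarrow>
    ((nat \<Rightarrow> nat) list \<Rightarrow> state \<Rightarrow> bool) \<Rightarrow> bool" where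
  "hoare n P p Q \<longleftrightarrow> (\<forall>xs s. vars s 0 = n \<longrightarrow> P xs s \<longrightarrow>
     vars (snd (sem p (xs, s))) 0 = n \<and> Q (fst (sem p (xs, s))) (snd (sem p (xs, s))))"

lemma hoareI:
  assumes "\<And>xs s. vars s 0 = n \<Longrightarrow> P xs s \<Longrightarrow>
    vars (snd (sem p (xs, s))) 0 = n \<and> Q (fst (sem p (xs, s))) (snd (sem p (xs, s)))"
  shows "hoare n P p Q"
  using assms by (simp add: hoare_def)

lemma hoareD:
  "hoare n P p Q \<Longrightarrow> vars s 0 = n \<Longrightarrow> P xs s \<Longrightarrow> sem p (xs, s) = (ys, t) \<Longrightarrow>
   vars t 0 = n \<and> Q ys t"
  by (metis fst_conv hoare_def snd_conv)

lemma hoare_seq: "hoare n P p R \<Longrightarrow> hoare n R q Q \<Longrightarrow> hoare n P (PSeq p q) Q"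
  by (simp add: hoare_def) (metis prod.collapse)

lemma hoare_conseq:
  assumes "hoare n P p Q"
    and "\<And>xs s. vars s 0 = n \<Longrightarrow> P' xs s \<Longrightarrow> P xs s"
    and "\<And>xs s. vars s 0 = n \<Longrightarrow> Q xs s \<Longrightarrow> Q' xs s"
  shows "hoare n P' p Q'"
  using assms unfolding hoare_def by blast

lemma hoare_frame:
  assumes "hoare n P p Q" and "x \<notin> writes p"
  shows "hoare n (\<lambda>xs s. P xs s \<and> vars s x = k) p (\<lambda>xs s. Q xs s \<and> vars s x = k)"
  using assms vars_sem[OF assms(2)] unfolding hoare_def by auto

text \<open>The invariant is indexed by the number of completed rounds. It must tolerate changes of
  \<open>x\<close>, since the counter is set and incremented outside the body.\<close>

lemma hoare_For:
  assumes x: "x \<notin> writes p" "x \<noteq> 0"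
    and body: "\<And>i. i < n \<Longrightarrow> hoare n (\<lambda>xs s. I i xs s \<and> vars s x = i) p (I (Suc i))"
    and ins: "\<And>i xs s k. I i xs s \<Longrightarrow> I i xs (set_var x k s)"
  shows "hoare n (I 0) (PFor x p) (I n)"
  unfolding hoare_def
proof (intro allI impI)
  fix xs s assume s: "vars s 0 = n" "I 0 xs s"
  define f where "f = (\<lambda>\<sigma>. apsnd (\<lambda>t. set_var x (vars t x + 1) t) (sem p \<sigma>))"
  have "vars (snd ((f ^^ j) (xs, set_var x 0 s))) 0 = n \<and> vars (snd ((f ^^ j) (xs, set_var x 0 s))) x = j \<and>
      I j (fst ((f ^^ j) (xs, set_var x 0 s))) (snd ((f ^^ j) (xs, set_var x 0 s)))" if "j \<le> n" for j
    using that
  proof (induction j)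
    case 0
    then show ?case using s x ins by auto
  next
    case (Suc j)
    obtain ys t where t: "(f ^^ j) (xs, set_var x 0 s) = (ys, t)" by (metis prod.collapse)
    have t': "vars t 0 = n" "vars t x = j" "I j ys t" using Suc t by auto
    have "(f ^^ Suc j) (xs, set_var x 0 s) = f (ys, t)" using t by simp
    then show ?case
      using body[of j] Suc.prems ins x t' vars_sem[OF x(1), of "(ys, t)"]
      by (auto simp: hoare_def f_def)
  qed
  from this[of n] s(1) show "vars (snd (sem (PFor x p) (xs, s))) 0 = n \<and>
      I n (fst (sem (PFor x p) (xs, s))) (snd (sem (PFor x p) (xs, s)))"
    by (simp add: f_def)
qed

text \<open>Indexing the invariant by the set of visited pairs hides the order of the visits from
  the body.\<close>

lemma hoare_For2:
  assumes "x \<notin> writes p" "y \<notin> writes p" "x \<noteq> 0" "y \<noteq> 0" "x \<noteq> y"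
    and body: "\<And>v w A. v < n \<Longrightarrow> w < n \<Longrightarrow> hoare n
      (\<lambda>xs s. J A xs s \<and> vars s x = v \<and> vars s y = w) p (J (insert (v, w) A))"
    and ins: "\<And>A xs s z k. z = x \<or> z = y \<Longrightarrow> J A xs s \<Longrightarrow> J A xs (set_var z k s)"
  shows "hoare n (J {}) (PFor x (PFor y p)) (J ({..<n} \<times> {..<n}))"
proof -
  have inner: "hoare n (\<lambda>xs s. J ({..<v} \<times> {..<n}) xs s \<and> vars s x = v) (PFor y p)
      (J ({..<Suc v} \<times> {..<n}))" if v: "v < n" for v
  proof -
    have "hoare n (\<lambda>xs s. J ({..<v} \<times> {..<n} \<union> {v} \<times> {..<0}) xs s \<and> vars s x = v) (PFor y p)
      (\<lambda>xs s. J ({..<v} \<times> {..<n} \<union> {v} \<times> {..<n}) xs s \<and> vars s x = v)"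
    proof (rule hoare_For)
      fix w assume w: "w < n"
      \<comment> \<open>Row-major order: the rows below \<open>v\<close> are complete and row
        \<open>v\<close> is done up to \<open>w\<close>.\<close>
      have *: "insert (v, w) ({..<v} \<times> {..<n} \<union> {v} \<times> {..<w}) =
          {..<v} \<times> {..<n} \<union> {v} \<times> {..<Suc w}"
        by auto
      show "hoare n (\<lambda>xs s. (J ({..<v} \<times> {..<n} \<union> {v} \<times> {..<w}) xs s \<and> vars s x = v) \<and> vars s y = w) p
        (\<lambda>xs s. J ({..<v} \<times> {..<n} \<union> {v} \<times> {..<Suc w}) xs s \<and> vars s x = v)"
        using hoare_frame[OF body[OF v w, of "{..<v} \<times> {..<n} \<union> {v} \<times> {..<w}"] assms(1), of v]
        unfolding * by (rule hoare_conseq) auto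
    qed (use assms in auto)
    moreover have "{..<v} \<times> {..<n} \<union> {v} \<times> {..<n} = {..<Suc v} \<times> {..<n}" by auto
    ultimately show ?thesis by (auto intro: hoare_conseq[where P = "\<lambda>xs s. J ({..<v} \<times> {..<n} \<union> {v} \<times> {..<0}) xs s \<and> vars s x = v"])
  qed
  have "hoare n (J ({..<0} \<times> {..<n})) (PFor x (PFor y p)) (J ({..<n} \<times> {..<n}))"
    by (rule hoare_For) (use assms inner in auto)
  then show ?thesis by simp
qed

text \<open>
  Nesting loops executes the body \<open>n ^ d\<close> times without any multiplication.  The counters start
  at 10 to stay clear of the variables used by loop bodies.
\<close>

primrec rep :: "nat \<Rightarrow> prog \<Rightarrow> prog" where
  "rep 0 p = p"
| "rep (Suc d) p = PFor (10 + d) (rep d p)"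

lemma writes_rep: "writes (rep d p) = writes p \<union> {10..<10 + d}"
  by (induction d) auto

lemma wf_rep: "wf_prog p \<Longrightarrow> writes p \<subseteq> {..<10} \<Longrightarrow> wf_prog (rep d p)"
  by (induction d) (auto simp: writes_rep)

lemma samples_rep: "samples n (rep d p) = n ^ d * samples n p"
  by (induction d) auto

lemma hoare_rep:
  assumes w: "writes p \<subseteq> {..<10}"
    and body: "\<And>j. j < n ^ d \<Longrightarrow> hoare n (I j) p (I (Suc j))"
    and ins: "\<And>j xs s x k. 10 \<le> x \<Longrightarrow> I j xs s \<Longrightarrow> I j xs (set_var x k s)"
  shows "hoare n (I 0) (rep d p) (I (n ^ d))"
proof -
  \<comment> \<open>The offset \<open>a\<close> is there for the inner loops, which start in the
    middle of the \<open>n ^ d\<close> executions.\<close>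
  have "hoare n (I a) (rep e p) (I (a + n ^ e))" if "a + n ^ e \<le> n ^ d" for a e
    using that
  proof (induction e arbitrary: a)
    case 0
    then show ?case using body[of a] by simp
  next
    case (Suc e)
    have "hoare n (I (a + 0 * n ^ e)) (PFor (10 + e) (rep e p)) (I (a + n * n ^ e))"
    proof (rule hoare_For)
      show "10 + e \<notin> writes (rep e p)" using w by (auto simp: writes_rep)
      fix i assume i: "i < n"
      have "Suc i * n ^ e \<le> n * n ^ e" using i by (intro mult_right_mono) auto
      then have "a + i * n ^ e + n ^ e \<le> n ^ d" using Suc.prems by simp
      from Suc.IH[OF this]
      show "hoare n (\<lambda>xs s. I (a + i * n ^ e) xs s \<and> vars s (10 + e) = i) (rep e p) (I (a + Suc i * n ^ e))"
        by (rule hoare_conseq) (auto simp: algebra_simps)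
    qed (use ins in auto)
    then show ?case by simp
  qed
  from this[of 0 d] show ?thesis by simp
qed

section \<open>The algorithm\<close>

text \<open>
  Memory layout.  Variable 2 holds the gap width \<open>D\<close>, variable 3 runs through the candidate
  thresholds, variable 4 is the chosen threshold, variable 5 a flag, variables 6 to 9 are loop
  counters, and variables from 10 on are the counters of \<open>rep\<close>.  Array 3 counts how
  often \<open>v\<close> was mapped to \<open>w\<close>, array 4 points to a row of array 2 with a sample doing
  so, and array 5 points to a certificate for each related pair.  Pointer 0 means "none"; this is
  why the identity occupies the rows 0 and 1 of array 2.
\<close>

definition spacing_prog :: "nat \<Rightarrow> prog" where
  "spacing_prog d = rep d (PAssign 2 (Plus (Var 2) (Const 1)))"

definition identity_prog :: prog where
  "identity_prog = PSeq (PAssign 1 (Const 2))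
     (PFor 7 (PSeq (PUpdate 2 (Const 0) (Var 7) (Var 7)) (PUpdate 2 (Const 1) (Var 7) (Var 7))))"

definition sampling_prog :: "nat \<Rightarrow> prog" where
  "sampling_prog d = rep d
     (PSeq PSample
     (PSeq (PFor 7
        (PSeq (PUpdate 2 (Var 1) (Var 7) (Drawn (Var 7)))
        (PSeq (PUpdate 3 (Var 7) (Drawn (Var 7)) (Plus (Elem 3 (Var 7) (Drawn (Var 7))) (Const 1)))
              (PUpdate 4 (Var 7) (Drawn (Var 7)) (Var 1)))))
     (PAssign 1 (Plus (Var 1) (Const 1)))))"

text \<open>In round j, counted from 0, variable 3 is first raised to t = (j + 1) D. The nested
  guards express h < t and t <= h + D, so the flag is cleared exactly by a count h in [j D, (j + 1)
  D). Variable 4 keeps the last threshold that survives.\<close>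

definition threshold_prog :: prog where
  "threshold_prog = rep 3
     (PSeq (PAssign 3 (Plus (Var 3) (Var 2)))
     (PSeq (PAssign 5 (Const 1))
     (PSeq (PFor 7 (PFor 8
        (PIf (Minus (Var 3) (Elem 3 (Var 7) (Var 8)))
          (PIf (Minus (Plus (Plus (Elem 3 (Var 7) (Var 8)) (Var 2)) (Const 1)) (Var 3))
            (PAssign 5 (Const 0)) PSkip)
          PSkip)))
     (PIf (Var 5) (PAssign 4 (Var 3)) PSkip))))"

text \<open>The guard h + 1 - t is nonzero iff t <= h. Reflexivity is added by pointing the diagonal
  to row 1, the identity.\<close>

definition relation_prog :: prog where
  "relation_prog = PSeq
     (PFor 7 (PFor 8
        (PIf (Minus (Plus (Elem 3 (Var 7) (Var 8)) (Const 1)) (Var 4))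
          (PUpdate 5 (Var 7) (Var 8) (Elem 4 (Var 7) (Var 8))) PSkip)))
     (PFor 7 (PUpdate 5 (Var 7) (Var 7) (Const 1)))"

text \<open>Warshall's algorithm, with the intermediate vertex in the outermost loop. Every composed
  certificate goes into a fresh row, so rows already pointed to stay valid.\<close>

definition closure_prog :: prog where
  "closure_prog = PFor 6 (PFor 7 (PFor 8
     (PIf (Elem 5 (Var 7) (Var 6))
       (PIf (Elem 5 (Var 6) (Var 8))
         (PSeq (PFor 9 (PUpdate 2 (Var 1) (Var 9)
             (Elem 2 (Elem 5 (Var 6) (Var 8)) (Elem 2 (Elem 5 (Var 7) (Var 6)) (Var 9)))))
         (PSeq (PUpdate 5 (Var 7) (Var 8) (Var 1))
           (PAssign 1 (Plus (Var 1) (Const 1)))))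
         PSkip)
       PSkip)))"

text \<open>Candidates are tried in increasing order and later writes overwrite earlier ones, so the
  label of a vertex is the greatest vertex related to it.\<close>

definition label_prog :: prog where
  "label_prog = PFor 8 (PFor 7
     (PIf (Elem 5 (Var 7) (Var 8)) (PUpdate 1 (Const 0) (Var 8) (Var 7)) PSkip))"

definition partition_prog :: "nat \<Rightarrow> nat \<Rightarrow> prog" where
  "partition_prog d e = PSeq (spacing_prog d) (PSeq identity_prog (PSeq (sampling_prog e)
     (PSeq threshold_prog (PSeq relation_prog (PSeq closure_prog label_prog)))))"

lemma wf_partition_prog: "wf_prog (partition_prog d e)"
  by (auto simp: partition_prog_def spacing_prog_def identity_prog_def sampling_prog_def
      threshold_prog_def relation_prog_def closure_prog_def label_prog_def intro!: wf_rep)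

lemma samples_partition_prog: "samples n (partition_prog d e) = n ^ e"
  by (auto simp: partition_prog_def spacing_prog_def identity_prog_def sampling_prog_def
      threshold_prog_def relation_prog_def closure_prog_def label_prog_def samples_rep)

section \<open>Invariants of the memory\<close>

definition hits :: "('a \<Rightarrow> 'b) list \<Rightarrow> 'a \<Rightarrow> 'b \<Rightarrow> nat" where
  "hits X v w = length (filter (\<lambda>\<phi>. \<phi> v = w) X)"

text \<open>Extending a row by the identity beyond n matches the normalisation of automorphisms and
  of output certificates.\<close>

definition table :: "nat \<Rightarrow> (nat \<Rightarrow> nat \<Rightarrow> nat) \<Rightarrow> nat \<Rightarrow> nat \<Rightarrow> nat" where
  "table n C k = (\<lambda>i. if i < n then C k i else i)"

lemma table_upd [simp]: "k \<noteq> m \<Longrightarrow> table n (C(m := r)) k = table n C k"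
  by (rule ext) (simp add: table_def)

text \<open>\<open>A\<close> will be the automorphism group. Row 1 is pinned to the identity because
  diagonal pairs will point to it.\<close>

definition certified :: "nat \<Rightarrow> (nat \<Rightarrow> nat) set \<Rightarrow> state \<Rightarrow> bool" where
  "certified n A s \<longleftrightarrow> 1 < vars s 1 \<and> (\<forall>v<n. arrays s 2 1 v = v) \<and> (\<forall>k<vars s 1. table n (arrays s 2) k \<in> A)"

definition linked :: "nat \<Rightarrow> nat \<Rightarrow> state \<Rightarrow> bool" where
  "linked n a s \<longleftrightarrow> (\<forall>v<n. \<forall>w<n. arrays s a v w \<noteq> 0 \<longrightarrow>
     arrays s a v w < vars s 1 \<and> arrays s 2 (arrays s a v w) v = w)"

definition gap :: "nat \<Rightarrow> nat \<Rightarrow> (nat \<Rightarrow> nat \<Rightarrow> nat) \<Rightarrow> nat \<Rightarrow> bool" where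
  "gap n D h i \<longleftrightarrow> (\<forall>v<n. \<forall>w<n. h v w < i * D \<or> Suc i * D \<le> h v w)"

definition rel :: "nat \<Rightarrow> state \<Rightarrow> (nat \<times> nat) set" where
  "rel n s = {(v, w). v < n \<and> w < n \<and> arrays s 5 v w \<noteq> 0}"

text \<open>\<open>X\<close> lists the samples processed so far; the offset 2 is due to the copies
  of the identity in rows 0 and 1.\<close>

definition sampled :: "nat \<Rightarrow> (nat \<Rightarrow> nat) set \<Rightarrow> nat \<Rightarrow> (nat \<Rightarrow> nat) list \<Rightarrow> state \<Rightarrow> bool" where
  "sampled n A D X s \<longleftrightarrow> vars s 2 = D \<and> vars s 3 = 0 \<and> vars s 1 = length X + 2 \<and>
     certified n A s \<and> linked n 4 s \<and> arrays s 5 = (\<lambda>_ _. 0) \<and>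
     (\<forall>v<n. \<forall>w<n. arrays s 3 v w = hits X v w \<and> (hits X v w \<noteq> 0 \<longrightarrow> arrays s 4 v w \<noteq> 0))"

section \<open>Hoare triples for the phases of the algorithm\<close>

lemma hoare_spacing:
  "hoare n (\<lambda>xs s. xs = X \<and> (\<forall>x. x \<noteq> 0 \<longrightarrow> vars s x = 0) \<and> (\<forall>a. a \<noteq> 0 \<longrightarrow> arrays s a = (\<lambda>_ _. 0)))
     (spacing_prog d)
     (\<lambda>xs s. xs = X \<and> vars s 2 = n ^ d \<and> vars s 3 = 0 \<and> (\<forall>a. a \<noteq> 0 \<longrightarrow> arrays s a = (\<lambda>_ _. 0)))"
proof -
  let ?I = "\<lambda>j xs s. xs = X \<and> vars s 2 = j \<and> vars s 3 = 0 \<and> (\<forall>a. a \<noteq> 0 \<longrightarrow> arrays s a = (\<lambda>_ _. 0))"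
  have "hoare n (?I 0) (spacing_prog d) (?I (n ^ d))"
    unfolding spacing_prog_def by (rule hoare_rep) (auto simp: hoare_def)
  then show ?thesis by (rule hoare_conseq) auto
qed

lemma hoare_identity:
  assumes "id \<in> A"
  shows "hoare n
     (\<lambda>xs s. xs = X \<and> vars s 2 = D \<and> vars s 3 = 0 \<and> (\<forall>a. a \<noteq> 0 \<longrightarrow> arrays s a = (\<lambda>_ _. 0)))
     identity_prog (\<lambda>xs s. xs = X \<and> sampled n A D [] s)"
proof -
  let ?P = "\<lambda>xs (s::state). xs = X \<and> vars s 2 = D \<and> vars s 3 = 0 \<and> (\<forall>a. a \<noteq> 0 \<and> a \<noteq> 2 \<longrightarrow> arrays s a = (\<lambda>_ _. 0))"
  let ?I = "\<lambda>i xs s. ?P xs s \<and> vars s 1 = 2 \<and> (\<forall>v<i. arrays s 2 0 v = v \<and> arrays s 2 1 v = v)"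
  have "hoare n ?P identity_prog (?I n)"
    unfolding identity_prog_def
  proof (rule hoare_seq)
    show "hoare n ?P (PAssign 1 (Const 2)) (?I 0)" by (auto simp: hoare_def)
    show "hoare n (?I 0) (PFor 7 (PSeq (PUpdate 2 (Const 0) (Var 7) (Var 7))
        (PUpdate 2 (Const 1) (Var 7) (Var 7)))) (?I n)"
      by (rule hoare_For) (auto simp: hoare_def less_Suc_eq)
  qed
  then show ?thesis
  proof (rule hoare_conseq)
    fix xs s assume *: "?I n xs s"
    have "table n (arrays s 2) 0 = id" "table n (arrays s 2) (Suc 0) = id" using * by (auto simp: table_def)
    then have "table n (arrays s 2) k \<in> A" if "k < 2" for k using that assms by (auto simp: less_2_cases_iff)
    then show "xs = X \<and> sampled n A D [] s"
      using * by (auto simp: sampled_def certified_def linked_def hits_def)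
  qed auto
qed

lemma hits_take_Suc:
  "j < length X \<Longrightarrow> hits (take (Suc j) X) v w = hits (take j X) v w + of_bool ((X ! j) v = w)"
  by (simp add: hits_def take_Suc_conv_app_nth)

lemma hoare_sampling:
  assumes X: "length X = n ^ e" "set X \<subseteq> A" and A: "\<And>\<phi>. \<phi> \<in> A \<Longrightarrow> \<phi> permutes {..<n}"
  shows "hoare n (\<lambda>xs s. xs = X \<and> sampled n A D [] s) (sampling_prog e) (\<lambda>xs s. sampled n A D X s)"
proof -
  let ?I = "\<lambda>j xs s. xs = drop j X \<and> sampled n A D (take j X) s"
  have "hoare n (?I 0) (sampling_prog e) (?I (n ^ e))"
    unfolding sampling_prog_def
  proof (rule hoare_rep)
    fix j assume "j < n ^ e"
    then have j: "j < length X" using X by simp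
    define \<phi> where "\<phi> = X ! j"
    define h where "h = hits (take j X)"
    define m where "m = j + 2"
    have \<phi>: "\<phi> \<in> A" using X j by (auto simp: \<phi>_def)
    have \<phi>n: "\<phi> i < n" if "i < n" for i using A[OF \<phi>] that by (metis lessThan_iff permutes_in_image)
    have m: "1 < m" by (simp add: m_def)
    \<comment> \<open>The state after \<open>i\<close> entries of the sample \<phi>: row
      \<open>m\<close> is filled up to \<open>i\<close>, the counts of these vertices include
      \<phi>, and only their pointers may already refer to row \<open>m\<close>, hence the bound
      \<open>Suc m\<close>.\<close>
    let ?K = "\<lambda>i xs s. xs = drop (Suc j) X \<and> drawn s = \<phi> \<and> vars s 2 = D \<and> vars s 3 = 0 \<and> vars s 1 = m \<and>
      arrays s 5 = (\<lambda>_ _. 0) \<and> (\<forall>v<n. arrays s 2 1 v = v) \<and> (\<forall>k<m. table n (arrays s 2) k \<in> A) \<and>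
      (\<forall>v<i. arrays s 2 m v = \<phi> v) \<and>
      (\<forall>v<n. \<forall>w<n. arrays s 4 v w \<noteq> 0 \<longrightarrow>
        arrays s 4 v w < (if v < i then Suc m else m) \<and> arrays s 2 (arrays s 4 v w) v = w) \<and>
      (\<forall>v<n. \<forall>w<n. arrays s 3 v w = h v w + of_bool (v < i \<and> \<phi> v = w) \<and>
        (arrays s 3 v w \<noteq> 0 \<longrightarrow> arrays s 4 v w \<noteq> 0))"
    show "hoare n (?I j) (PSeq PSample
     (PSeq (PFor 7
        (PSeq (PUpdate 2 (Var 1) (Var 7) (Drawn (Var 7)))
        (PSeq (PUpdate 3 (Var 7) (Drawn (Var 7)) (Plus (Elem 3 (Var 7) (Drawn (Var 7))) (Const 1)))
              (PUpdate 4 (Var 7) (Drawn (Var 7)) (Var 1)))))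
     (PAssign 1 (Plus (Var 1) (Const 1))))) (?I (Suc j))"
    proof (intro hoare_seq)
      show "hoare n (?I j) PSample (?K 0)"
      proof (rule hoareI, goal_cases)
        case (1 xs s)
        then show ?case
          using j by (auto simp: sampled_def certified_def linked_def m_def h_def \<phi>_def
            hd_drop_conv_nth drop_Suc tl_drop)
      qed
      show "hoare n (?K 0) (PFor 7
        (PSeq (PUpdate 2 (Var 1) (Var 7) (Drawn (Var 7)))
        (PSeq (PUpdate 3 (Var 7) (Drawn (Var 7)) (Plus (Elem 3 (Var 7) (Drawn (Var 7))) (Const 1)))
              (PUpdate 4 (Var 7) (Drawn (Var 7)) (Var 1))))) (?K n)"
      proof (rule hoare_For)
        fix i assume i: "i < n"
        show "hoare n (\<lambda>xs s. ?K i xs s \<and> vars s 7 = i)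
            (PSeq (PUpdate 2 (Var 1) (Var 7) (Drawn (Var 7)))
            (PSeq (PUpdate 3 (Var 7) (Drawn (Var 7)) (Plus (Elem 3 (Var 7) (Drawn (Var 7))) (Const 1)))
              (PUpdate 4 (Var 7) (Drawn (Var 7)) (Var 1)))) (?K (Suc i))"
        proof (rule hoareI, goal_cases)
          case (1 xs s)
          let ?C = "(arrays s 2)(m := (arrays s 2 m)(i := \<phi> i))"
          let ?h = "(arrays s 3)(i := (arrays s 3 i)(\<phi> i := Suc (arrays s 3 i (\<phi> i))))"
          let ?l = "(arrays s 4)(i := (arrays s 4 i)(\<phi> i := m))"
          have K: "?K i xs s" and s7: "vars s 7 = i" using 1(2) by blast+
          have C: "\<forall>v<Suc i. ?C m v = \<phi> v" using K by (auto simp: less_Suc_eq)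
          have C1: "\<forall>v<n. ?C 1 v = v" using K m by auto
          have T: "\<forall>k<m. table n ?C k \<in> A" using K by auto
          \<comment> \<open>Writing entry \<open>i\<close> of row \<open>m\<close> breaks no old
            link: a vertex before \<open>i\<close> may point to row \<open>m\<close> but reads
            another entry, and all other old pointers lie below \<open>m\<close>.\<close>
          have L: "\<forall>v<n. \<forall>w<n. ?l v w \<noteq> 0 \<longrightarrow>
              ?l v w < (if v < Suc i then Suc m else m) \<and> ?C (?l v w) v = w"
          proof (intro allI impI)
            fix v w assume v: "v < n" "w < n" "?l v w \<noteq> 0"
            have old: "arrays s 4 v w < (if v < i then Suc m else m) \<and> arrays s 2 (arrays s 4 v w) v = w"
              if "arrays s 4 v w \<noteq> 0" using K v that by blast
            show "?l v w < (if v < Suc i then Suc m else m) \<and> ?C (?l v w) v = w"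
              using old v(3) by (cases "v < i"; cases "v = i"; cases "w = \<phi> i") auto
          qed
          have H: "\<forall>v<n. \<forall>w<n. ?h v w = h v w + of_bool (v < Suc i \<and> \<phi> v = w) \<and>
              (?h v w \<noteq> 0 \<longrightarrow> ?l v w \<noteq> 0)"
          proof (intro allI impI)
            fix v w assume v: "v < n" "w < n"
            have old: "arrays s 3 v w = h v w + of_bool (v < i \<and> \<phi> v = w) \<and>
              (arrays s 3 v w \<noteq> 0 \<longrightarrow> arrays s 4 v w \<noteq> 0)" using K v by blast
            show "?h v w = h v w + of_bool (v < Suc i \<and> \<phi> v = w) \<and> (?h v w \<noteq> 0 \<longrightarrow> ?l v w \<noteq> 0)"
              using old m by (cases "v < i"; cases "v = i"; cases "w = \<phi> i") auto
          qed
          show ?case using 1(1) K s7 C C1 T L H by simp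
        qed
      qed auto
      show "hoare n (?K n) (PAssign 1 (Plus (Var 1) (Const 1))) (?I (Suc j))"
      proof (rule hoareI, goal_cases)
        case (1 xs s)
        have "table n (arrays s 2) m = \<phi>"
          using 1(2) permutes_not_in[OF A[OF \<phi>]] by (auto simp: table_def)
        then have T: "\<forall>k<Suc m. table n (arrays s 2) k \<in> A" using 1(2) \<phi> by (auto simp: less_Suc_eq)
        have H: "\<forall>v<n. \<forall>w<n. arrays s 3 v w = hits (take (Suc j) X) v w \<and>
            (hits (take (Suc j) X) v w \<noteq> 0 \<longrightarrow> arrays s 4 v w \<noteq> 0)"
          using 1(2) j by (simp add: hits_take_Suc h_def \<phi>_def)
        show ?case using 1 T H j by (simp add: sampled_def certified_def linked_def m_def)
      qed
    qed
  qed (auto simp: sampled_def certified_def linked_def)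
  then show ?thesis by (rule hoare_conseq) (use X in auto)
qed

text \<open>What remains of \<open>sampled\<close> once the work variables and array 5 begin to
  change.\<close>

definition counted :: "nat \<Rightarrow> (nat \<Rightarrow> nat) set \<Rightarrow> (nat \<Rightarrow> nat) list \<Rightarrow> state \<Rightarrow> bool" where
  "counted n A X s \<longleftrightarrow> certified n A s \<and> linked n 4 s \<and>
     (\<forall>v<n. \<forall>w<n. arrays s 3 v w = hits X v w \<and> (hits X v w \<noteq> 0 \<longrightarrow> arrays s 4 v w \<noteq> 0))"

lemma certified_set_var [simp]: "x \<noteq> 1 \<Longrightarrow> certified n A (set_var x k s) = certified n A s"
  by (simp add: certified_def)

lemma linked_set_var [simp]: "x \<noteq> 1 \<Longrightarrow> linked n a (set_var x k s) = linked n a s"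
  by (simp add: linked_def)

lemma counted_set_var [simp]: "x \<noteq> 1 \<Longrightarrow> counted n A X (set_var x k s) = counted n A X s"
  by (simp add: counted_def)

lemma rel_set_var [simp]: "rel n (set_var x k s) = rel n s"
  by (simp add: rel_def)

lemma certified_set_elem [simp]: "a \<noteq> 2 \<Longrightarrow> certified n A (set_elem a i j k s) = certified n A s"
  by (simp add: certified_def)

lemma linked_set_elem [simp]:
  "b \<noteq> a \<Longrightarrow> b \<noteq> 2 \<Longrightarrow> linked n a (set_elem b i j k s) = linked n a s"
  by (simp add: linked_def)

lemma counted_set_elem [simp]:
  "b \<notin> {2, 3, 4} \<Longrightarrow> counted n A X (set_elem b i j k s) = counted n A X s"
  by (simp add: counted_def)

lemma rel_set_elem [simp]: "a \<noteq> 5 \<Longrightarrow> rel n (set_elem a i j k s) = rel n s"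
  by (simp add: rel_def)

lemma hoare_threshold:
  assumes ex: "\<exists>i<n ^ 3. gap n D (hits X) i"
  shows "hoare n (\<lambda>xs s. sampled n A D X s) threshold_prog
    (\<lambda>xs s. counted n A X s \<and> arrays s 5 = (\<lambda>_ _. 0) \<and>
      (\<exists>i<n ^ 3. gap n D (hits X) i \<and> vars s 4 = Suc i * D))"
proof -
  let ?B = "\<lambda>s. counted n A X s \<and> arrays s 5 = (\<lambda>_ _. 0) \<and> vars s 2 = D"
  \<comment> \<open>Variable 4 is meaningful only after some candidate has succeeded, hence the
    disjunction; \<open>ex\<close> excludes the first alternative at the end.\<close>
  let ?Z = "\<lambda>j (s :: state). (\<forall>i<j. \<not> gap n D (hits X) i) \<or>
    (\<exists>i<j. gap n D (hits X) i \<and> vars s 4 = Suc i * D)"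
  let ?I = "\<lambda>j xs s. ?B s \<and> vars s 3 = j * D \<and> ?Z j s"
  have "hoare n (?I 0) threshold_prog (?I (n ^ 3))"
    unfolding threshold_prog_def
  proof (rule hoare_rep)
    fix j
    define spread where "spread = (\<lambda>v w. hits X v w < j * D \<or> Suc j * D \<le> hits X v w)"
    let ?J = "\<lambda>P xs s. ?B s \<and> vars s 3 = Suc j * D \<and> ?Z j s \<and>
      (vars s 5 \<noteq> 0 \<longleftrightarrow> (\<forall>(v, w)\<in>P. spread v w))"
    show "hoare n (?I j) (PSeq (PAssign 3 (Plus (Var 3) (Var 2)))
     (PSeq (PAssign 5 (Const 1))
     (PSeq (PFor 7 (PFor 8
        (PIf (Minus (Var 3) (Elem 3 (Var 7) (Var 8)))
          (PIf (Minus (Plus (Plus (Elem 3 (Var 7) (Var 8)) (Var 2)) (Const 1)) (Var 3))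
            (PAssign 5 (Const 0)) PSkip)
          PSkip)))
     (PIf (Var 5) (PAssign 4 (Var 3)) PSkip)))) (?I (Suc j))"
    proof (intro hoare_seq)
      show "hoare n (?I j) (PAssign 3 (Plus (Var 3) (Var 2)))
          (\<lambda>xs s. ?B s \<and> vars s 3 = Suc j * D \<and> ?Z j s)"
        by (rule hoareI) simp
      show "hoare n (\<lambda>xs s. ?B s \<and> vars s 3 = Suc j * D \<and> ?Z j s) (PAssign 5 (Const 1)) (?J {})"
        by (rule hoareI) simp
      show "hoare n (?J {}) (PFor 7 (PFor 8
        (PIf (Minus (Var 3) (Elem 3 (Var 7) (Var 8)))
          (PIf (Minus (Plus (Plus (Elem 3 (Var 7) (Var 8)) (Var 2)) (Const 1)) (Var 3))
            (PAssign 5 (Const 0)) PSkip)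
          PSkip))) (?J ({..<n} \<times> {..<n}))"
      proof (rule hoare_For2)
        fix v w P assume v: "v < n" "w < n"
        show "hoare n (\<lambda>xs s. ?J P xs s \<and> vars s 7 = v \<and> vars s 8 = w)
          (PIf (Minus (Var 3) (Elem 3 (Var 7) (Var 8)))
          (PIf (Minus (Plus (Plus (Elem 3 (Var 7) (Var 8)) (Var 2)) (Const 1)) (Var 3))
            (PAssign 5 (Const 0)) PSkip)
          PSkip) (?J (insert (v, w) P))"
        proof (rule hoareI, goal_cases)
          case (1 xs s)
          have "arrays s 3 v w = hits X v w" using 1 v by (auto simp: counted_def)
          moreover have "spread v w \<longleftrightarrow> hits X v w < j * D \<or> j * D + D \<le> hits X v w"
            by (simp add: spread_def add.commute)
          ultimately show ?case using 1 by auto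
        qed
      qed auto
      have gap: "gap n D (hits X) j \<longleftrightarrow> (\<forall>(v, w)\<in>{..<n} \<times> {..<n}. spread v w)"
        by (auto simp: gap_def spread_def)
      show "hoare n (?J ({..<n} \<times> {..<n})) (PIf (Var 5) (PAssign 4 (Var 3)) PSkip) (?I (Suc j))"
      proof (rule hoareI, goal_cases)
        case (1 xs s)
        have g: "vars s 5 \<noteq> 0 \<longleftrightarrow> gap n D (hits X) j" unfolding gap using 1 by blast
        show ?case
        proof (cases "gap n D (hits X) j")
          case True
          then show ?thesis using 1 g by auto
        next
          case False
          then have "?Z (Suc j) s" using 1 by (auto simp: less_Suc_eq)
          moreover have "vars s 5 = 0" using g False by blast
          moreover have "?B s \<and> vars s 3 = Suc j * D" using 1 by blast
          ultimately show ?thesis using 1(1) by simp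
        qed
      qed
    qed
  qed auto
  then show ?thesis
  proof (rule hoare_conseq)
    fix xs s assume "?I (n ^ 3) xs s"
    then show "counted n A X s \<and> arrays s 5 = (\<lambda>_ _. 0) \<and>
      (\<exists>i<n ^ 3. gap n D (hits X) i \<and> vars s 4 = Suc i * D)" using ex by blast
  qed (auto simp: sampled_def counted_def)
qed

text \<open>A positive threshold is reached only by pairs that were hit, and their pointers in array
  4 differ from the value 0 for "none". Copying these pointers therefore really relates the
  pairs.\<close>

lemma hoare_relation:
  assumes "0 < \<tau>"
  shows "hoare n (\<lambda>xs s. counted n A X s \<and> arrays s 5 = (\<lambda>_ _. 0) \<and> vars s 4 = \<tau>) relation_prog
    (\<lambda>xs s. certified n A s \<and> linked n 5 s \<and>
       rel n s = {(v, w). v < n \<and> w < n \<and> (\<tau> \<le> hits X v w \<or> v = w)})"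
proof -
  let ?P = "\<lambda>xs s. counted n A X s \<and> arrays s 5 = (\<lambda>_ _. 0) \<and> vars s 4 = \<tau>"
  let ?J = "\<lambda>B xs s. counted n A X s \<and> vars s 4 = \<tau> \<and> (\<forall>v<n. \<forall>w<n.
     arrays s 5 v w = (if (v, w) \<in> B \<and> \<tau> \<le> hits X v w then arrays s 4 v w else 0))"
  let ?I = "\<lambda>i xs s. counted n A X s \<and> (\<forall>v<n. \<forall>w<n.
     arrays s 5 v w = (if v = w \<and> v < i then 1 else if \<tau> \<le> hits X v w then arrays s 4 v w else 0))"
  have 1: "hoare n (?J {}) (PFor 7 (PFor 8
        (PIf (Minus (Plus (Elem 3 (Var 7) (Var 8)) (Const 1)) (Var 4))
          (PUpdate 5 (Var 7) (Var 8) (Elem 4 (Var 7) (Var 8))) PSkip))) (?J ({..<n} \<times> {..<n}))"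
  proof (rule hoare_For2)
    fix v w B assume v: "v < n" "w < n"
    show "hoare n (\<lambda>xs s. ?J B xs s \<and> vars s 7 = v \<and> vars s 8 = w)
        (PIf (Minus (Plus (Elem 3 (Var 7) (Var 8)) (Const 1)) (Var 4))
          (PUpdate 5 (Var 7) (Var 8) (Elem 4 (Var 7) (Var 8))) PSkip) (?J (insert (v, w) B))"
    proof (rule hoareI, goal_cases)
      case (1 xs s)
      have "arrays s 3 v w = hits X v w" using 1 v by (auto simp: counted_def)
      then show ?case using 1 by auto
    qed
  qed auto
  have 2: "hoare n (?I 0) (PFor 7 (PUpdate 5 (Var 7) (Var 7) (Const 1))) (?I n)"
    by (rule hoare_For) (auto intro!: hoareI)
  have "hoare n ?P relation_prog (?I n)"
    unfolding relation_prog_def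
    by (rule hoare_seq[OF hoare_conseq[OF 1] hoare_conseq[OF 2]]) auto
  then show ?thesis
  proof (rule hoare_conseq)
    fix xs s assume I: "?I n xs s"
    have A5: "arrays s 5 v w = (if v = w then 1 else if \<tau> \<le> hits X v w then arrays s 4 v w else 0)"
      if "v < n" "w < n" for v w using I that by auto
    have c: "certified n A s" "linked n 4 s"
      "\<And>v w. v < n \<Longrightarrow> w < n \<Longrightarrow> \<tau> \<le> hits X v w \<Longrightarrow> arrays s 4 v w \<noteq> 0"
      using I assms unfolding counted_def by (blast, blast, metis leD)
    have "linked n 5 s"
      using c(1,2) by (auto simp: linked_def A5 certified_def split: if_splits)
    moreover have "rel n s = {(v, w). v < n \<and> w < n \<and> (\<tau> \<le> hits X v w \<or> v = w)}"
      using c(3) by (auto simp: rel_def A5 split: if_splits)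
    ultimately show "certified n A s \<and> linked n 5 s \<and>
       rel n s = {(v, w). v < n \<and> w < n \<and> (\<tau> \<le> hits X v w \<or> v = w)}" using c(1) by simp
  qed auto
qed

text \<open>The two rows being composed lie below the row \<open>vars s0 1\<close> being written, so
  they keep their values throughout the loop.\<close>

lemma hoare_compose_row:
  assumes "arrays s0 5 u w < vars s0 1" "arrays s0 5 v u < vars s0 1"
    and "vars s0 6 = u" "vars s0 7 = v" "vars s0 8 = w"
  shows "hoare n (\<lambda>xs s. s = s0) (PFor 9 (PUpdate 2 (Var 1) (Var 9)
       (Elem 2 (Elem 5 (Var 6) (Var 8)) (Elem 2 (Elem 5 (Var 7) (Var 6)) (Var 9)))))
    (\<lambda>xs s. (\<forall>x. x \<noteq> 9 \<longrightarrow> vars s x = vars s0 x) \<and> (\<forall>a. a \<noteq> 2 \<longrightarrow> arrays s a = arrays s0 a) \<and>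
       (\<forall>k. k \<noteq> vars s0 1 \<longrightarrow> arrays s 2 k = arrays s0 2 k) \<and>
       (\<forall>i<n. arrays s 2 (vars s0 1) i =
          arrays s0 2 (arrays s0 5 u w) (arrays s0 2 (arrays s0 5 v u) i)))"
proof -
  let ?I = "\<lambda>i xs s. (\<forall>x. x \<noteq> 9 \<longrightarrow> vars s x = vars s0 x) \<and> (\<forall>a. a \<noteq> 2 \<longrightarrow> arrays s a = arrays s0 a) \<and>
       (\<forall>k. k \<noteq> vars s0 1 \<longrightarrow> arrays s 2 k = arrays s0 2 k) \<and>
       (\<forall>i'<i. arrays s 2 (vars s0 1) i' =
          arrays s0 2 (arrays s0 5 u w) (arrays s0 2 (arrays s0 5 v u) i'))"
  have "hoare n (?I 0) (PFor 9 (PUpdate 2 (Var 1) (Var 9)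
       (Elem 2 (Elem 5 (Var 6) (Var 8)) (Elem 2 (Elem 5 (Var 7) (Var 6)) (Var 9))))) (?I n)"
  proof (rule hoare_For)
    fix i
    show "hoare n (\<lambda>xs s. ?I i xs s \<and> vars s 9 = i) (PUpdate 2 (Var 1) (Var 9)
       (Elem 2 (Elem 5 (Var 6) (Var 8)) (Elem 2 (Elem 5 (Var 7) (Var 6)) (Var 9)))) (?I (Suc i))"
    proof (rule hoareI, goal_cases)
      case (1 xs s)
      have "arrays s 2 (arrays s0 5 u w) = arrays s0 2 (arrays s0 5 u w)"
        "arrays s 2 (arrays s0 5 v u) = arrays s0 2 (arrays s0 5 v u)"
        using 1(2) assms by (metis less_irrefl)+
      then show ?case using 1 assms by (simp add: less_Suc_eq)
    qed
  qed auto
  then show ?thesis by (rule hoare_conseq) auto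
qed

text \<open>Warshall's algorithm computes the closure, and closure of \<open>A\<close> under
  composition keeps the new certificates in \<open>A\<close>.\<close>

lemma hoare_closure:
  assumes A: "\<And>\<phi>. \<phi> \<in> A \<Longrightarrow> \<phi> permutes {..<n}"
    and comp: "\<And>\<phi> \<psi>. \<phi> \<in> A \<Longrightarrow> \<psi> \<in> A \<Longrightarrow> \<phi> \<circ> \<psi> \<in> A"
  shows "hoare n (\<lambda>xs s. certified n A s \<and> linked n 5 s \<and> rel n s = R) closure_prog
    (\<lambda>xs s. certified n A s \<and> linked n 5 s \<and> rel n s = R\<^sup>+)"
proof -
  let ?body = "PIf (Elem 5 (Var 7) (Var 6))
       (PIf (Elem 5 (Var 6) (Var 8))
         (PSeq (PFor 9 (PUpdate 2 (Var 1) (Var 9)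
             (Elem 2 (Elem 5 (Var 6) (Var 8)) (Elem 2 (Elem 5 (Var 7) (Var 6)) (Var 9)))))
         (PSeq (PUpdate 5 (Var 7) (Var 8) (Var 1))
           (PAssign 1 (Plus (Var 1) (Const 1)))))
         PSkip)
       PSkip"
  let ?C = "\<lambda>s. certified n A s \<and> linked n 5 s"
  \<comment> \<open>\<open>Q\<close> is the relation at the start of round \<open>u\<close>, and
    \<open>B\<close> the set of visited pairs. Updating in place is harmless: a pair (v, u) or (u,
    w) is added only if it is already in \<open>Q\<close>.\<close>
  let ?J = "\<lambda>Q u B xs s. ?C s \<and> vars s 6 = u \<and>
     rel n s = Q \<union> {(v, w). (v, w) \<in> B \<and> (v, u) \<in> Q \<and> (u, w) \<in> Q}"
  have body: "hoare n (\<lambda>xs s. ?J Q u B xs s \<and> vars s 7 = v \<and> vars s 8 = w) ?body (?J Q u (insert (v, w) B))"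
    if uvw: "u < n" "v < n" "w < n" for Q u v w B
  proof (rule hoareI, goal_cases)
    case (1 xs s)
    have C: "certified n A s" "linked n 5 s" and r: "vars s 6 = u" "vars s 7 = v" "vars s 8 = w"
      and rel: "rel n s = Q \<union> {(v, w). (v, w) \<in> B \<and> (v, u) \<in> Q \<and> (u, w) \<in> Q}" using 1 by auto
    have vu: "arrays s 5 v u \<noteq> 0 \<longleftrightarrow> (v, u) \<in> Q" and uw: "arrays s 5 u w \<noteq> 0 \<longleftrightarrow> (u, w) \<in> Q"
      using rel uvw unfolding rel_def by blast+
    show ?case
    proof (cases "(v, u) \<in> Q \<and> (u, w) \<in> Q")
      case False
      have "Q \<union> {(v', w'). (v', w') \<in> insert (v, w) B \<and> (v', u) \<in> Q \<and> (u, w') \<in> Q} =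
          Q \<union> {(v, w). (v, w) \<in> B \<and> (v, u) \<in> Q \<and> (u, w) \<in> Q}" using False by auto
      then show ?thesis using False 1 vu uw by (simp del: insert_iff)
    next
      case True
      define a where "a = arrays s 5 u w"
      define b where "b = arrays s 5 v u"
      define m where "m = vars s 1"
      define p where "p = PFor 9 (PUpdate 2 (Var 1) (Var 9)
             (Elem 2 (Elem 5 (Var 6) (Var 8)) (Elem 2 (Elem 5 (Var 7) (Var 6)) (Var 9))))"
      have ab: "a \<noteq> 0" "b \<noteq> 0" using True vu uw by (auto simp: a_def b_def)
      have a: "a < m" "arrays s 2 a u = w" and b: "b < m" "arrays s 2 b v = u"
        using C(2) ab uvw by (auto simp: linked_def a_def b_def m_def)
      obtain ys t where t: "sem p (xs, s) = (ys, t)" by (metis prod.collapse)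
      have t1: "\<And>x. x \<noteq> 9 \<Longrightarrow> vars t x = vars s x" "\<And>c. c \<noteq> 2 \<Longrightarrow> arrays t c = arrays s c"
        "\<And>k. k \<noteq> m \<Longrightarrow> arrays t 2 k = arrays s 2 k"
        "\<And>i. i < n \<Longrightarrow> arrays t 2 m i = arrays s 2 a (arrays s 2 b i)"
        using hoareD[OF hoare_compose_row[of s u w v n, folded p_def] 1(1) refl t] a b r
        by (auto simp: a_def b_def m_def)
      define t' where "t' = set_var 1 (Suc m) (set_elem 5 v w m t)"
      have sem: "sem ?body (xs, s) = (ys, t')"
        using ab r t t1 by (simp add: a_def b_def m_def p_def t'_def)
      have t': "vars t' 0 = n" "vars t' 1 = Suc m" "vars t' 6 = u" "arrays t' 2 = arrays t 2"
        "arrays t' 5 = (arrays s 5)(v := (arrays s 5 v)(w := m))"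
        using 1(1) r t1 by (auto simp: t'_def)
      have m: "1 < m" using C(1) by (simp add: certified_def m_def)
      have tab: "table n (arrays t 2) k = table n (arrays s 2) k" if "k \<noteq> m" for k
        using t1(3)[OF that] by (intro ext) (simp add: table_def)
      have TA: "table n (arrays s 2) k \<in> A" if "k < m" for k
        using C(1) that by (simp add: certified_def m_def)
      \<comment> \<open>Row \<open>b\<close> sends \<open>v\<close> to \<open>u\<close> and row
        \<open>a\<close> sends \<open>u\<close> to \<open>w\<close>, so the composite certifies the
        new pair.\<close>
      have "table n (arrays t 2) m = table n (arrays s 2) a \<circ> table n (arrays s 2) b"
      proof
        fix i
        have "table n (arrays s 2) b i < n" if "i < n"
          using permutes_in_image[OF A[OF TA[OF b(1)]]] that by (metis lessThan_iff)
        then show "table n (arrays t 2) m i = (table n (arrays s 2) a \<circ> table n (arrays s 2) b) i"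
          using t1(4)[of i] by (simp add: table_def)
      qed
      then have "table n (arrays t 2) m \<in> A" using comp TA a b by simp
      then have "table n (arrays t 2) k \<in> A" if "k < Suc m" for k
        using that TA tab by (cases "k = m") auto
      moreover have "\<forall>i<n. arrays t 2 1 i = i" using t1(3)[of 1] m C(1) by (simp add: certified_def)
      ultimately have cert: "certified n A t'" using m t' by (simp add: certified_def)
      have "linked n 5 t'"
        unfolding linked_def
      proof (intro allI impI)
        fix v' w' assume v': "v' < n" "w' < n" "arrays t' 5 v' w' \<noteq> 0"
        show "arrays t' 5 v' w' < vars t' 1 \<and> arrays t' 2 (arrays t' 5 v' w') v' = w'"
        proof (cases "v' = v \<and> w' = w")
          case True
          then show ?thesis using t' t1(4)[OF uvw(2)] a b by simp
        next
          case False
          then have eq: "arrays t' 5 v' w' = arrays s 5 v' w'" using t' by auto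
          then have "arrays s 5 v' w' < m \<and> arrays s 2 (arrays s 5 v' w') v' = w'"
            using v' C(2) by (simp add: linked_def m_def)
          then show ?thesis using eq t' t1(3)[of "arrays s 5 v' w'"] by simp
        qed
      qed
      moreover have "rel n t' = Q \<union> {(v', w'). (v', w') \<in> insert (v, w) B \<and> (v', u) \<in> Q \<and> (u, w') \<in> Q}"
      proof -
        have "rel n t' = insert (v, w) (rel n s)"
        proof (rule set_eqI, clarify)
          fix x y
          show "(x, y) \<in> rel n t' \<longleftrightarrow> (x, y) \<in> insert (v, w) (rel n s)"
            using m uvw by (cases "x = v"; cases "y = w") (auto simp: rel_def t'(5))
        qed
        then show ?thesis unfolding rel using True by auto
      qed
      ultimately show ?thesis unfolding sem using t' cert by (simp del: insert_iff)
    qed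
  qed
  \<comment> \<open>Warshall's invariant: the relation lies between \<open>R\<close> and its closure
    and is transitive through every intermediate vertex below \<open>i\<close>. At
    \<open>i = n\<close> this is full transitivity, which forces the closure.\<close>
  let ?I = "\<lambda>i xs s. ?C s \<and> R \<subseteq> rel n s \<and> rel n s \<subseteq> R\<^sup>+ \<and>
    (\<forall>u<i. \<forall>v w. (v, u) \<in> rel n s \<longrightarrow> (u, w) \<in> rel n s \<longrightarrow> (v, w) \<in> rel n s)"
  have "hoare n (?I 0) closure_prog (?I n)"
    unfolding closure_prog_def
  proof (rule hoare_For)
    fix u assume u: "u < n"
    have inner: "hoare n (?J Q u {}) (PFor 7 (PFor 8 ?body)) (?J Q u ({..<n} \<times> {..<n}))" for Q
      by (rule hoare_For2) (use body[OF u] in auto)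
    show "hoare n (\<lambda>xs s. ?I u xs s \<and> vars s 6 = u) (PFor 7 (PFor 8 ?body)) (?I (Suc u))"
    proof (rule hoareI, goal_cases)
      case (1 xs s)
      define Q where "Q = rel n s"
      obtain ys t where t: "sem (PFor 7 (PFor 8 ?body)) (xs, s) = (ys, t)" by (metis prod.collapse)
      have "?J Q u {} xs s" using 1 by (simp add: Q_def)
      from hoareD[OF inner 1(1) this t]
      have post: "vars t 0 = n" "?C t"
        "rel n t = Q \<union> {(v, w). (v, w) \<in> {..<n} \<times> {..<n} \<and> (v, u) \<in> Q \<and> (u, w) \<in> Q}"
        by simp_all
      have Q: "R \<subseteq> Q" "Q \<subseteq> R\<^sup>+"
        "\<And>u' v w. u' < u \<Longrightarrow> (v, u') \<in> Q \<Longrightarrow> (u', w) \<in> Q \<Longrightarrow> (v, w) \<in> Q"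
        using 1(2) by (auto simp: Q_def)
      have Qn: "Q \<subseteq> {..<n} \<times> {..<n}" by (auto simp: Q_def rel_def)
      have rel: "rel n t = Q \<union> {(v, w). (v, u) \<in> Q \<and> (u, w) \<in> Q}"
        unfolding post(3) using Qn by blast
      have "Q \<union> {(v, w). (v, u) \<in> Q \<and> (u, w) \<in> Q} \<subseteq> R\<^sup>+"
        using Q(2) by (auto intro: trancl_trans)
      \<comment> \<open>For \<open>u' = u\<close>, pairs into or out of \<open>u\<close> were in
        \<open>Q\<close> already; for smaller \<open>u'\<close>, the transitivity of
        \<open>Q\<close> through \<open>u'\<close> settles each combination.\<close>
      moreover have "(v, w) \<in> Q \<union> {(v, w). (v, u) \<in> Q \<and> (u, w) \<in> Q}"
        if "u' < Suc u" "(v, u') \<in> Q \<union> {(v, w). (v, u) \<in> Q \<and> (u, w) \<in> Q}"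
          "(u', w) \<in> Q \<union> {(v, w). (v, u) \<in> Q \<and> (u, w) \<in> Q}" for u' v w
        using that Q(3)[of u'] by (auto simp: less_Suc_eq)
      ultimately have "?I (Suc u) ys t"
        unfolding rel using post(2) Q(1) by blast
      then show ?case using post(1) unfolding t fst_conv snd_conv by blast
    qed
  qed auto
  then show ?thesis
  proof (rule hoare_conseq)
    fix xs s assume I: "?I n xs s"
    have "trans (rel n s)"
    proof (rule transI)
      fix v u w assume vu: "(v, u) \<in> rel n s" "(u, w) \<in> rel n s"
      then have "u < n" by (simp add: rel_def)
      then show "(v, w) \<in> rel n s" using I vu by blast
    qed
    then have "(rel n s)\<^sup>+ = rel n s" by (rule trancl_id)
    moreover have "R\<^sup>+ \<subseteq> (rel n s)\<^sup>+" using I by (intro trancl_mono_subset) blast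
    ultimately have "R\<^sup>+ \<subseteq> rel n s" by simp
    then show "certified n A s \<and> linked n 5 s \<and> rel n s = R\<^sup>+" using I by blast
  qed auto
qed

lemma hoare_label:
  "hoare n (\<lambda>xs s. certified n A s \<and> linked n 5 s \<and> rel n s = T) label_prog
    (\<lambda>xs s. certified n A s \<and> linked n 5 s \<and> rel n s = T \<and>
       (\<forall>w<n. \<forall>v. (v, w) \<in> T \<longrightarrow> (arrays s 1 0 w, w) \<in> T \<and> v \<le> arrays s 1 0 w))"
proof -
  let ?C = "\<lambda>s. certified n A s \<and> linked n 5 s \<and> rel n s = T"
  let ?L = "\<lambda>s w i. \<forall>v<i. (v, w) \<in> T \<longrightarrow> (arrays s 1 0 w, w) \<in> T \<and> v \<le> arrays s 1 0 w"
  let ?I = "\<lambda>j xs s. ?C s \<and> (\<forall>w<j. ?L s w n)"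
  have "hoare n (?I 0) label_prog (?I n)"
    unfolding label_prog_def
  proof (rule hoare_For)
    fix w assume w: "w < n"
    let ?K = "\<lambda>i xs s. ?I w xs s \<and> ?L s w i \<and> vars s 8 = w"
    have "hoare n (?K 0) (PFor 7 (PIf (Elem 5 (Var 7) (Var 8)) (PUpdate 1 (Const 0) (Var 8) (Var 7)) PSkip)) (?K n)"
    proof (rule hoare_For)
      fix i assume i: "i < n"
      show "hoare n (\<lambda>xs s. ?K i xs s \<and> vars s 7 = i)
        (PIf (Elem 5 (Var 7) (Var 8)) (PUpdate 1 (Const 0) (Var 8) (Var 7)) PSkip) (?K (Suc i))"
      proof (rule hoareI, goal_cases)
        case (1 xs s)
        have "arrays s 5 i w \<noteq> 0 \<longleftrightarrow> (i, w) \<in> T" using 1 i w by (auto simp: rel_def)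
        then show ?case using 1 by (auto simp: less_Suc_eq)
      qed
    qed auto
    then show "hoare n (\<lambda>xs s. ?I w xs s \<and> vars s 8 = w)
        (PFor 7 (PIf (Elem 5 (Var 7) (Var 8)) (PUpdate 1 (Const 0) (Var 8) (Var 7)) PSkip)) (?I (Suc w))"
      by (rule hoare_conseq) (auto simp: less_Suc_eq)
  qed auto
  then show ?thesis
    by (rule hoare_conseq) (auto simp: rel_def)
qed

text \<open>The triples of all phases chained together. The group enters only as a set
  \<open>A\<close> of permutations that contains the identity and is closed under
  composition.\<close>

lemma partition_prog_spec:
  fixes s0 :: state
  assumes X: "length X = n ^ e" "set X \<subseteq> A"
    and A: "\<And>\<phi>. \<phi> \<in> A \<Longrightarrow> \<phi> permutes {..<n}" "id \<in> A"
    and comp: "\<And>\<phi> \<psi>. \<phi> \<in> A \<Longrightarrow> \<psi> \<in> A \<Longrightarrow> \<phi> \<circ> \<psi> \<in> A"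
    and ex: "\<exists>i<n ^ 3. gap n (n ^ d) (hits X) i" and n: "0 < n"
    and s0: "vars s0 0 = n" "\<And>x. x \<noteq> 0 \<Longrightarrow> vars s0 x = 0" "\<And>a. a \<noteq> 0 \<Longrightarrow> arrays s0 a = (\<lambda>_ _. 0)"
    and s: "s = snd (sem (partition_prog d e) (X, s0))"
  shows "certified n A s \<and> linked n 5 s \<and> (\<exists>i<n ^ 3. gap n (n ^ d) (hits X) i \<and>
     rel n s = {(v, w). v < n \<and> w < n \<and> (Suc i * n ^ d \<le> hits X v w \<or> v = w)}\<^sup>+) \<and>
     (\<forall>w<n. \<forall>v. (v, w) \<in> rel n s \<longrightarrow> (arrays s 1 0 w, w) \<in> rel n s \<and> v \<le> arrays s 1 0 w)"
proof -
  let ?R = "\<lambda>i. {(v, w). v < n \<and> w < n \<and> (Suc i * n ^ d \<le> hits X v w \<or> v = w)}"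
  let ?S = "\<lambda>s. certified n A s \<and> linked n 5 s \<and> (\<exists>i<n ^ 3. gap n (n ^ d) (hits X) i \<and>
     rel n s = (?R i)\<^sup>+) \<and>
     (\<forall>w<n. \<forall>v. (v, w) \<in> rel n s \<longrightarrow> (arrays s 1 0 w, w) \<in> rel n s \<and> v \<le> arrays s 1 0 w)"
  \<comment> \<open>The search only guarantees that some threshold was chosen, whereas
    \<open>hoare_relation\<close> is about a definite one; it is fixed here for the remaining
    phases.\<close>
  have tail: "hoare n (\<lambda>xs s. counted n A X s \<and> arrays s 5 = (\<lambda>_ _. 0) \<and>
      (\<exists>i<n ^ 3. gap n (n ^ d) (hits X) i \<and> vars s 4 = Suc i * n ^ d))
      (PSeq relation_prog (PSeq closure_prog label_prog)) (\<lambda>xs s. ?S s)"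
  proof (rule hoareI, goal_cases)
    case (1 xs s)
    then obtain i where i: "i < n ^ 3" "gap n (n ^ d) (hits X) i" "vars s 4 = Suc i * n ^ d" by blast
    have "0 < Suc i * n ^ d" using n by simp
    from hoare_seq[OF hoare_relation[OF this] hoare_seq[OF hoare_closure[OF A(1) comp] hoare_label]]
    have h: "hoare n (\<lambda>xs s. counted n A X s \<and> arrays s 5 = (\<lambda>_ _. 0) \<and> vars s 4 = Suc i * n ^ d)
      (PSeq relation_prog (PSeq closure_prog label_prog))
      (\<lambda>xs s. certified n A s \<and> linked n 5 s \<and> rel n s = (?R i)\<^sup>+ \<and>
       (\<forall>w<n. \<forall>v. (v, w) \<in> (?R i)\<^sup>+ \<longrightarrow> (arrays s 1 0 w, w) \<in> (?R i)\<^sup>+ \<and> v \<le> arrays s 1 0 w))"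
      by blast
    obtain ys t where t: "sem (PSeq relation_prog (PSeq closure_prog label_prog)) (xs, s) = (ys, t)"
      by (metis prod.collapse)
    have pre: "counted n A X s \<and> arrays s 5 = (\<lambda>_ _. 0) \<and> vars s 4 = Suc i * n ^ d"
      using 1 i by blast
    from hoareD[OF h 1(1) pre t] have "vars t 0 = n" "?S t" using i(1,2) by auto
    then show ?case unfolding t fst_conv snd_conv by blast
  qed
  have "hoare n (\<lambda>xs s. xs = X \<and> (\<forall>x. x \<noteq> 0 \<longrightarrow> vars s x = 0) \<and> (\<forall>a. a \<noteq> 0 \<longrightarrow> arrays s a = (\<lambda>_ _. 0)))
      (partition_prog d e) (\<lambda>xs s. ?S s)"
    unfolding partition_prog_def
    by (rule hoare_seq[OF hoare_spacing hoare_seq[OF hoare_identity[OF A(2)]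
          hoare_seq[OF hoare_sampling[OF X A(1)] hoare_seq[OF hoare_threshold[OF ex] tail]]]])
  moreover obtain ys where "sem (partition_prog d e) (X, s0) = (ys, s)"
    unfolding s by (metis prod.collapse)
  ultimately show ?thesis using hoareD s0 by blast
qed

section \<open>Invariant partitions from counts\<close>

text \<open>Pigeonhole: the quotients by \<open>D\<close> take at most \<open>n * n\<close> values,
  fewer than \<open>n ^ 3\<close> as n is at least 2, so some index is missed.\<close>

lemma gap_exists:
  assumes "2 \<le> n" "0 < D"
  shows "\<exists>i<n ^ 3. gap n D h i"
proof -
  let ?f = "\<lambda>(v, w). h v w div D"
  have "card (?f ` ({..<n} \<times> {..<n})) \<le> card ({..<n} \<times> {..<n})" by (intro card_image_le) auto
  also have "\<dots> = n * n * 1" by simp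
  also have "\<dots> < n * n * n" using assms(1) by (intro mult_strict_left_mono) auto
  also have "\<dots> = card {..<n ^ 3}" by (simp add: power3_eq_cube)
  finally have "\<not> {..<n ^ 3} \<subseteq> ?f ` ({..<n} \<times> {..<n})"
    by (metis card_mono finite_SigmaI finite_imageI finite_lessThan leD)
  then obtain i where i: "i < n ^ 3" "i \<notin> ?f ` ({..<n} \<times> {..<n})" by blast
  have "h v w < i * D \<or> Suc i * D \<le> h v w" if "v < n" "w < n" for v w
  proof (rule ccontr)
    assume "\<not> ?thesis"
    then have "h v w div D = i" by (intro div_nat_eqI) (auto simp: mult.commute)
    then show False using i(2) that by (auto intro: rev_image_eqI[of "(v, w)"])
  qed
  then show ?thesis using i(1) by (auto simp: gap_def)
qed

text \<open>A nonidentity permutation moves some vertex and so adds at least 1 to the off-diagonal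
  sum.\<close>

lemma sum_hits_ge:
  fixes X :: "(nat \<Rightarrow> nat) list"
  assumes "\<And>\<phi>. \<phi> \<in> set X \<Longrightarrow> \<phi> permutes {..<n} \<and> \<phi> \<noteq> id"
  shows "length X \<le> (\<Sum>(v, w)\<in>{(v, w). v < n \<and> w < n \<and> v \<noteq> w}. hits X v w)"
  using assms
proof (induction X)
  case (Cons \<phi> X)
  let ?E = "{(v, w). v < n \<and> w < n \<and> v \<noteq> w}"
  have fin: "finite ?E" by (rule finite_subset[of _ "{..<n} \<times> {..<n}"]) auto
  have \<phi>: "\<phi> permutes {..<n}" "\<phi> \<noteq> id" using Cons.prems[OF list.set_intros(1)] by blast+
  then obtain v where v: "\<phi> v \<noteq> v" by fastforce
  have "v < n" using \<phi>(1) v by (metis lessThan_iff permutes_not_in)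
  then have mem: "(v, \<phi> v) \<in> ?E" using v permutes_in_image[OF \<phi>(1), of v] by auto
  have "1 = (\<Sum>(v', w)\<in>{(v, \<phi> v)}. of_bool (\<phi> v' = w) :: nat)" by simp
  also have "\<dots> \<le> (\<Sum>(v, w)\<in>?E. of_bool (\<phi> v = w))" using mem fin by (intro sum_mono2) auto
  finally have "1 \<le> (\<Sum>(v, w)\<in>?E. of_bool (\<phi> v = w) :: nat)" .
  moreover have "(\<Sum>(v, w)\<in>?E. hits (\<phi> # X) v w) =
      (\<Sum>(v, w)\<in>?E. of_bool (\<phi> v = w)) + (\<Sum>(v, w)\<in>?E. hits X v w)"
    unfolding sum.distrib[symmetric] by (intro sum.cong) (auto simp: hits_def)
  ultimately show ?case using Cons by simp
qed auto

text \<open>Averaging: if all of the at most \<open>n ^ 2\<close> off-diagonal counts were below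
  \<tau>, their sum would fall short of the number of samples.\<close>

lemma frequent_pair_exists:
  fixes X :: "(nat \<Rightarrow> nat) list"
  assumes "\<And>\<phi>. \<phi> \<in> set X \<Longrightarrow> \<phi> permutes {..<n} \<and> \<phi> \<noteq> id"
    and "0 < n" "0 < \<tau>" "n ^ 2 * \<tau> \<le> length X"
  shows "\<exists>v<n. \<exists>w<n. v \<noteq> w \<and> \<tau> \<le> hits X v w"
proof (rule ccontr)
  assume *: "\<not> ?thesis"
  let ?E = "{(v, w). v < n \<and> w < n \<and> v \<noteq> w}"
  have "?E \<subseteq> {..<n} \<times> {..<n}" by auto
  from card_mono[OF _ this] have E: "card ?E \<le> n ^ 2" by (simp add: power2_eq_square)
  have "length X \<le> (\<Sum>(v, w)\<in>?E. hits X v w)" by (rule sum_hits_ge[OF assms(1)])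
  also have "\<dots> \<le> (\<Sum>(v, w)\<in>?E. \<tau> - 1)" using * by (intro sum_mono) (fastforce simp: not_le)
  also have "\<dots> = card ?E * (\<tau> - 1)" by simp
  also have "\<dots> \<le> n ^ 2 * (\<tau> - 1)" using E by (rule mult_right_mono) simp
  also have "\<dots> < n ^ 2 * \<tau>" using assms by (intro mult_strict_left_mono) auto
  finally show False using assms(4) by simp
qed

section \<open>The automorphism group and its orbits\<close>

lemma id_Aut: "id \<in> Aut G"
  by (simp add: Aut_def permutes_id)

lemma Aut_permutes: "\<psi> \<in> Aut G \<Longrightarrow> \<psi> permutes pverts G"
  by (simp add: Aut_def)

lemma comp_Aut: "\<phi> \<in> Aut G \<Longrightarrow> \<psi> \<in> Aut G \<Longrightarrow> \<phi> \<circ> \<psi> \<in> Aut G"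
  by (simp add: Aut_def permutes_compose permutes_in_image)

lemma inv_Aut:
  assumes "\<psi> \<in> Aut G"
  shows "inv \<psi> \<in> Aut G"
proof -
  have p: "\<psi> permutes pverts G" using assms by (rule Aut_permutes)
  have ip: "inv \<psi> permutes pverts G" using p by (rule permutes_inv)
  have "(inv \<psi> u, inv \<psi> v) \<in> parcs G \<longleftrightarrow> (u, v) \<in> parcs G" if "u \<in> pverts G" "v \<in> pverts G" for u v
  proof -
    have "inv \<psi> u \<in> pverts G" "inv \<psi> v \<in> pverts G" using that permutes_in_image[OF ip] by auto
    then have "(\<psi> (inv \<psi> u), \<psi> (inv \<psi> v)) \<in> parcs G \<longleftrightarrow> (inv \<psi> u, inv \<psi> v) \<in> parcs G"
      using assms by (simp add: Aut_def)
    then show ?thesis using permutes_inverses(1)[OF p] by simp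
  qed
  then show ?thesis using ip by (simp add: Aut_def)
qed

lemma orbit_partition_partition_on: "partition_on (pverts G) (orbit_partition G)"
proof -
  \<comment> \<open>Composing with \<phi> or its inverse shows that any point of an orbit generates
    it; hence orbits that meet coincide.\<close>
  have orb: "w \<in> (\<lambda>\<psi>. \<psi> v) ` Aut G \<Longrightarrow> (\<lambda>\<psi>. \<psi> w) ` Aut G = (\<lambda>\<psi>. \<psi> v) ` Aut G" for v w
  proof -
    assume "w \<in> (\<lambda>\<psi>. \<psi> v) ` Aut G"
    then obtain \<phi> where \<phi>: "\<phi> \<in> Aut G" "w = \<phi> v" by blast
    have inv: "inv \<phi> w = v" using \<phi> permutes_inverses(2)[OF Aut_permutes[OF \<phi>(1)]] by simp
    show ?thesis
    proof (intro equalityI subsetI)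
      fix x assume "x \<in> (\<lambda>\<psi>. \<psi> w) ` Aut G"
      then obtain \<psi> where "\<psi> \<in> Aut G" "x = \<psi> w" by blast
      then show "x \<in> (\<lambda>\<psi>. \<psi> v) ` Aut G"
        using \<phi> by (intro image_eqI[of _ _ "\<psi> \<circ> \<phi>"]) (auto intro: comp_Aut)
    next
      fix x assume "x \<in> (\<lambda>\<psi>. \<psi> v) ` Aut G"
      then obtain \<psi> where "\<psi> \<in> Aut G" "x = \<psi> v" by blast
      moreover from this have "x = (\<psi> \<circ> inv \<phi>) w" using inv by simp
      ultimately show "x \<in> (\<lambda>\<psi>. \<psi> w) ` Aut G"
        using \<phi>(1) by (blast intro: comp_Aut inv_Aut)
    qed
  qed
  show ?thesis
    unfolding orbit_partition_def
  proof (rule partition_onI)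
    show "\<Union> ((\<lambda>v. (\<lambda>\<psi>. \<psi> v) ` Aut G) ` pverts G) = pverts G"
    proof (intro equalityI subsetI)
      fix x assume "x \<in> \<Union> ((\<lambda>v. (\<lambda>\<psi>. \<psi> v) ` Aut G) ` pverts G)"
      then obtain v \<psi> where "v \<in> pverts G" and \<psi>: "\<psi> \<in> Aut G" and "x = \<psi> v" by blast
      then show "x \<in> pverts G" using permutes_in_image[OF Aut_permutes[OF \<psi>]] by simp
    next
      fix x assume "x \<in> pverts G"
      moreover have "x \<in> (\<lambda>\<psi>. \<psi> x) ` Aut G" by (rule image_eqI[OF _ id_Aut]) simp
      ultimately show "x \<in> \<Union> ((\<lambda>v. (\<lambda>\<psi>. \<psi> v) ` Aut G) ` pverts G)" by blast
    qed
  next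
    fix P Q
    assume "P \<in> (\<lambda>v. (\<lambda>\<psi>. \<psi> v) ` Aut G) ` pverts G" "Q \<in> (\<lambda>v. (\<lambda>\<psi>. \<psi> v) ` Aut G) ` pverts G"
      and ne: "P \<noteq> Q"
    then obtain v w where vw: "P = (\<lambda>\<psi>. \<psi> v) ` Aut G" "Q = (\<lambda>\<psi>. \<psi> w) ` Aut G" by blast
    have "P = Q" if "x \<in> P" "x \<in> Q" for x
      using orb[of x v] orb[of x w] that unfolding vw by simp
    then show "disjnt P Q" using ne unfolding disjnt_def by blast
  next
    show "{} \<notin> (\<lambda>v. (\<lambda>\<psi>. \<psi> v) ` Aut G) ` pverts G" using id_Aut by blast
  qed
qed

text \<open>
  An automorphism \<open>\<phi>\<close> has finite order, so following \<open>v \<mapsto> \<phi> v\<close> leads back to \<open>v\<close>.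
\<close>

lemma invariant_relation_sym:
  assumes inv: "\<And>\<psi> v w. \<psi> \<in> Aut G \<Longrightarrow> (v, w) \<in> T \<Longrightarrow> (\<psi> v, \<psi> w) \<in> T"
    and tr: "trans T" and fin: "finite (pverts G)"
    and \<phi>: "\<phi> \<in> Aut G" and vw: "(v, \<phi> v) \<in> T"
  shows "(\<phi> v, v) \<in> T"
proof -
  have perm: "permutation \<phi>" using Aut_permutes[OF \<phi>] fin permutation_permutes by blast
  obtain k where k: "(\<phi> ^^ k) = id" "0 < k" using permutation_is_nilpotent[OF perm] by metis
  have step: "((\<phi> ^^ j) v, (\<phi> ^^ Suc j) v) \<in> T" for j
    by (induction j) (use vw inv[OF \<phi>] in auto)
  \<comment> \<open>Transitivity glues the edges along the cycle, beginning at
    \<open>\<phi> v\<close>; at exponent \<open>k\<close> the path is back at \<open>v\<close>. The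
    case \<open>k = 1\<close> has no edge to follow and is treated apart, with \<phi> the
    identity.\<close>
  have path: "j \<noteq> 0 \<Longrightarrow> (\<phi> v, (\<phi> ^^ Suc j) v) \<in> T" for j
  proof (induction j)
    case (Suc j)
    then show ?case using step[of "Suc j"] tr by (cases "j = 0") (auto dest: transD)
  qed simp
  show ?thesis
  proof (cases "k = 1")
    case True
    then show ?thesis using k vw by simp
  next
    case False
    then obtain j where "k = Suc j" "j \<noteq> 0" using k(2) by (cases k) auto
    then show ?thesis using path[of j] k(1) by (metis id_apply)
  qed
qed

text \<open>\<open>T\<close> is symmetric because its pairs are realised by automorphisms, so it is
  an equivalence and \<open>l\<close> picks the greatest element of each class. Invariance comes
  from \<open>T\<close>, refinement of the orbits from the certificates.\<close>

lemma correct_output_labels: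
  assumes G: "input_graph G" and n: "n = card (pverts G)"
    and T: "T \<subseteq> {..<n} \<times> {..<n}" "trans T" "\<And>v. v < n \<Longrightarrow> (v, v) \<in> T"
    and inv: "\<And>\<psi> v w. \<psi> \<in> Aut G \<Longrightarrow> (v, w) \<in> T \<Longrightarrow> (\<psi> v, \<psi> w) \<in> T"
    and cert: "\<And>v w. (v, w) \<in> T \<Longrightarrow> \<exists>\<phi>\<in>\<Phi>. \<phi> v = w" and \<Phi>: "finite \<Phi>" "\<Phi> \<subseteq> Aut G"
    and nontriv: "(a, b) \<in> T" "a \<noteq> b"
    and lab: "\<And>v w. (v, w) \<in> T \<Longrightarrow> (l w, w) \<in> T \<and> v \<le> (l w :: nat)"
  shows "correct_output G ((\<lambda>v. {w \<in> pverts G. l w = l v}) ` pverts G) \<Phi>"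
proof -
  have V: "pverts G = {..<n}" using G n by (simp add: input_graph_def)
  have sym: "(w, v) \<in> T" if vw: "(v, w) \<in> T" for v w
  proof -
    obtain \<phi> where "\<phi> \<in> Aut G" "\<phi> v = w" using cert[OF vw] \<Phi> by blast
    then show ?thesis using invariant_relation_sym[of G T \<phi> v] inv T(2) vw V by auto
  qed
  have lab_eq: "l w = l v \<longleftrightarrow> (v, w) \<in> T" if "v < n" "w < n" for v w
  proof
    assume "l w = l v"
    then have "(l v, v) \<in> T" "(l v, w) \<in> T" using lab[OF T(3)[OF that(1)]] lab[OF T(3)[OF that(2)]] by auto
    then show "(v, w) \<in> T" using sym T(2) by (meson transD)
  next
    \<comment> \<open>Each label is related to the other vertex, hence bounded by the other
      label.\<close>
    assume vw: "(v, w) \<in> T"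
    have "(l v, v) \<in> T" "(l w, w) \<in> T" using lab T(3) that by blast+
    then have "(l v, w) \<in> T" "(l w, v) \<in> T" using vw sym[OF vw] T(2) by (meson transD)+
    then show "l w = l v" using lab by (meson le_antisym)
  qed
  define cls where "cls v = {w. (v, w) \<in> T}" for v
  have "{w \<in> pverts G. l w = l v} = cls v" if "v < n" for v
    using lab_eq[OF that] T(1) by (auto simp: V cls_def)
  then have pi: "(\<lambda>v. {w \<in> pverts G. l w = l v}) ` pverts G = cls ` {..<n}"
    unfolding V by (intro image_cong) auto
  have part: "partition_on (pverts G) (cls ` {..<n})"
  proof (rule partition_onI)
    show "\<Union> (cls ` {..<n}) = pverts G" using T(1,3) by (auto simp: V cls_def)
    fix P Q assume "P \<in> cls ` {..<n}" "Q \<in> cls ` {..<n}" "P \<noteq> Q"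
    then obtain v w where vw: "P = cls v" "Q = cls w" by blast
    have "P = Q" if "x \<in> P" "x \<in> Q" for x
    proof -
      have "(v, x) \<in> T" "(w, x) \<in> T" using that vw by (auto simp: cls_def)
      then have "(v, w) \<in> T" "(w, v) \<in> T" using sym T(2) by (meson transD)+
      then show ?thesis using T(2) by (auto simp: vw cls_def dest: transD)
    qed
    then show "disjnt P Q" using \<open>P \<noteq> Q\<close> unfolding disjnt_def by blast
  next
    show "{} \<notin> cls ` {..<n}" using T(3) by (auto simp: cls_def)
  qed
  have "\<not> discrete_partition (cls ` {..<n})"
  proof -
    have "a < n" using nontriv(1) T(1) by auto
    then have "cls a \<in> cls ` {..<n}" "a \<in> cls a" "b \<in> cls a" using nontriv T(3) by (auto simp: cls_def)
    moreover have "\<not> is_singleton (cls a)"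
      using \<open>a \<in> cls a\<close> \<open>b \<in> cls a\<close> nontriv(2) by (metis is_singletonE singletonD)
    ultimately show ?thesis by (auto simp: discrete_partition_def)
  qed
  moreover have "refines (pverts G) (cls ` {..<n}) (orbit_partition G)"
    unfolding refines_def
  proof (intro conjI part orbit_partition_partition_on ballI)
    fix P assume "P \<in> cls ` {..<n}"
    then obtain v where v: "v < n" "P = cls v" by blast
    have "P \<subseteq> (\<lambda>\<psi>. \<psi> v) ` Aut G" using cert \<Phi>(2) unfolding v cls_def by blast
    then show "\<exists>Q\<in>orbit_partition G. P \<subseteq> Q" using v V by (auto simp: orbit_partition_def)
  qed
  moreover have "(`) \<psi> ` cls ` {..<n} = cls ` {..<n}" if \<psi>: "\<psi> \<in> Aut G" for \<psi>
  proof -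
    have p: "\<psi> permutes {..<n}" using Aut_permutes[OF \<psi>] V by simp
    \<comment> \<open>One inclusion is invariance under \<psi>, the other invariance under its
      inverse.\<close>
    have "\<psi> ` cls v = cls (\<psi> v)" for v
    proof (intro equalityI subsetI)
      fix x assume "x \<in> \<psi> ` cls v"
      then show "x \<in> cls (\<psi> v)" using inv[OF \<psi>] by (auto simp: cls_def)
    next
      fix x assume "x \<in> cls (\<psi> v)"
      then have "(inv \<psi> (\<psi> v), inv \<psi> x) \<in> T" using inv[OF inv_Aut[OF \<psi>]] by (simp add: cls_def)
      then have "inv \<psi> x \<in> cls v" using permutes_inverses(2)[OF p] by (simp add: cls_def)
      then show "x \<in> \<psi> ` cls v" using permutes_inverses(1)[OF p] by (metis image_eqI)
    qed
    then have "(`) \<psi> ` cls ` {..<n} = cls ` \<psi> ` {..<n}" by (simp add: image_image)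
    then show ?thesis using permutes_image[OF p] by simp
  qed
  moreover have "\<forall>P\<in>cls ` {..<n}. \<forall>v\<in>P. \<forall>v'\<in>P. \<exists>\<phi>\<in>\<Phi>. \<phi> v = v'"
  proof (intro ballI)
    fix P v v' assume "P \<in> cls ` {..<n}" "v \<in> P" "v' \<in> P"
    then obtain u where "(u, v) \<in> T" "(u, v') \<in> T" by (auto simp: cls_def)
    then have "(v, v') \<in> T" using sym T(2) by (meson transD)
    then show "\<exists>\<phi>\<in>\<Phi>. \<phi> v = v'" by (rule cert)
  qed
  ultimately show ?thesis unfolding correct_output_def pi using part \<Phi> by blast
qed

text \<open>The event controlled by concentration. The one-sided inequality bounds differences in
  both directions, since \<psi> may be replaced by its inverse.\<close>

definition balanced :: "nat pair_pre_digraph \<Rightarrow> nat \<Rightarrow> (nat \<Rightarrow> nat) list \<Rightarrow> bool" where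
  "balanced G D X \<longleftrightarrow> (\<forall>\<psi>\<in>Aut G. \<forall>v\<in>pverts G. \<forall>w\<in>pverts G. hits X v w < hits X (\<psi> v) (\<psi> w) + D)"

text \<open>The deterministic half of the argument: chance enters only through
  \<open>balanced\<close>.\<close>

lemma partition_prog_correct:
  assumes G: "input_graph G" and n: "n = card (pverts G)" "2 \<le> n"
    and X: "length X = n ^ (d + 5)" "set X \<subseteq> Aut G - {id}" and bal: "balanced G (n ^ d) X"
    and s: "s = snd (sem (partition_prog d (d + 5)) (X, init_state G))"
  shows "correct_output G (output_partition (pverts G) s) (output_certificate_set (pverts G) s)"
proof -
  have V: "pverts G = {..<n}" using G n by (simp add: input_graph_def)
  define D where "D = n ^ d"
  have D: "0 < D" using n by (simp add: D_def)
  have P: "\<phi> permutes {..<n}" if "\<phi> \<in> Aut G" for \<phi> using Aut_permutes[OF that] V by simp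
  have XA: "set X \<subseteq> Aut G" using X(2) by blast
  have "certified n (Aut G) s \<and> linked n 5 s \<and> (\<exists>i<n ^ 3. gap n (n ^ d) (hits X) i \<and>
     rel n s = {(v, w). v < n \<and> w < n \<and> (Suc i * n ^ d \<le> hits X v w \<or> v = w)}\<^sup>+) \<and>
     (\<forall>w<n. \<forall>v. (v, w) \<in> rel n s \<longrightarrow> (arrays s 1 0 w, w) \<in> rel n s \<and> v \<le> arrays s 1 0 w)"
    by (rule partition_prog_spec[OF X(1) XA P id_Aut comp_Aut gap_exists _ _ _ _ s])
      (use n D in \<open>auto simp: init_state_def D_def\<close>)
  then obtain i where cert: "certified n (Aut G) s" and link: "linked n 5 s" and i: "i < n ^ 3"
    and gap: "gap n D (hits X) i"
    and rel: "rel n s = {(v, w). v < n \<and> w < n \<and> (Suc i * D \<le> hits X v w \<or> v = w)}\<^sup>+"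
    and lab: "\<And>v w. w < n \<Longrightarrow> (v, w) \<in> rel n s \<Longrightarrow> (arrays s 1 0 w, w) \<in> rel n s \<and> v \<le> arrays s 1 0 w"
    unfolding D_def by blast
  define R where "R = {(v, w). v < n \<and> w < n \<and> (Suc i * D \<le> hits X v w \<or> v = w)}"
  \<comment> \<open>Passing to the image pair lowers a count of at least \<open>Suc i * D\<close> by
    less than \<open>D\<close>, so it stays at least \<open>i * D\<close>; the gap then lifts it
    back to at least \<open>Suc i * D\<close>.\<close>
  have R: "(\<psi> v, \<psi> w) \<in> R" if \<psi>: "\<psi> \<in> Aut G" and vw: "(v, w) \<in> R" for \<psi> v w
  proof -
    have vn: "v < n" "w < n" using vw by (auto simp: R_def)
    have \<psi>n: "\<psi> v < n" "\<psi> w < n" using permutes_in_image[OF P[OF \<psi>]] vn by auto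
    show ?thesis
    proof (cases "v = w")
      case True
      then show ?thesis using \<psi>n by (simp add: R_def)
    next
      case False
      then have "Suc i * D \<le> hits X v w" using vw by (simp add: R_def)
      moreover have "hits X v w < hits X (\<psi> v) (\<psi> w) + D"
        using bal \<psi> vn V by (simp add: balanced_def D_def)
      ultimately have "i * D \<le> hits X (\<psi> v) (\<psi> w)" by simp
      moreover have "hits X (\<psi> v) (\<psi> w) < i * D \<or> Suc i * D \<le> hits X (\<psi> v) (\<psi> w)"
        using gap \<psi>n unfolding gap_def by blast
      ultimately have "Suc i * D \<le> hits X (\<psi> v) (\<psi> w)" by linarith
      then show ?thesis using \<psi>n by (simp add: R_def)
    qed
  qed
  have inv: "(\<psi> v, \<psi> w) \<in> R\<^sup>+" if \<psi>: "\<psi> \<in> Aut G" and vw: "(v, w) \<in> R\<^sup>+" for \<psi> v w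
    using vw by (induction) (use R[OF \<psi>] in \<open>auto intro: trancl_into_trancl\<close>)
  have rel: "rel n s = R\<^sup>+" using rel by (simp add: R_def)
  \<comment> \<open>Origin of the exponent 5: a factor \<open>n ^ 2\<close> for averaging over pairs
    and \<open>n ^ 3\<close> for the largest possible threshold \<open>n ^ 3 * D\<close>.\<close>
  have "n ^ 2 * (Suc i * D) \<le> n ^ 2 * (n ^ 3 * D)" using i by (intro mult_left_mono mult_right_mono) auto
  also have "\<dots> = length X" by (simp add: X(1) D_def add.commute[of d] flip: power_add)
  finally have len: "n ^ 2 * (Suc i * D) \<le> length X" .
  have "\<phi> permutes {..<n} \<and> \<phi> \<noteq> id" if "\<phi> \<in> set X" for \<phi> using X(2) P that by blast
  from frequent_pair_exists[OF this _ _ len] n(2) D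
  obtain a b where ab: "a < n" "b < n" "a \<noteq> b" "Suc i * D \<le> hits X a b" by auto
  have cset: "output_certificate_set (pverts G) s = table n (arrays s 2) ` {..<vars s 1}"
    by (auto simp: output_certificate_set_def table_def V)
  show ?thesis
    unfolding output_partition_def
  proof (rule correct_output_labels[OF G n(1), of "R\<^sup>+"])
    show "R\<^sup>+ \<subseteq> {..<n} \<times> {..<n}" unfolding rel[symmetric] by (auto simp: rel_def)
    show "trans (R\<^sup>+)" by (rule trans_trancl)
    show "(v, v) \<in> R\<^sup>+" if "v < n" for v using that by (auto simp: R_def)
    show "(a, b) \<in> R\<^sup>+" using ab by (auto simp: R_def)
    show "a \<noteq> b" by (rule ab)
    show "(\<psi> v, \<psi> w) \<in> R\<^sup>+" if "\<psi> \<in> Aut G" "(v, w) \<in> R\<^sup>+" for \<psi> v w using inv that by blast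
    show "finite (output_certificate_set (pverts G) s)" by (simp add: cset)
    show "output_certificate_set (pverts G) s \<subseteq> Aut G"
      using cert by (auto simp: cset certified_def)
    show "\<exists>\<phi>\<in>output_certificate_set (pverts G) s. \<phi> v = w" if "(v, w) \<in> R\<^sup>+" for v w
    proof -
      have "v < n" "w < n" "arrays s 5 v w \<noteq> 0" using that unfolding rel[symmetric] by (auto simp: rel_def)
      then have "arrays s 5 v w < vars s 1" "table n (arrays s 2) (arrays s 5 v w) v = w"
        using link by (auto simp: linked_def table_def)
      then show ?thesis unfolding cset by blast
    qed
    show "(arrays s 1 0 w, w) \<in> R\<^sup>+ \<and> v \<le> arrays s 1 0 w" if "(v, w) \<in> R\<^sup>+" for v w
      using lab[of w v] that unfolding rel[symmetric] by (auto simp: rel_def)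
  qed
qed

section \<open>Concentration of the counts\<close>

lemma map_replicate_pmf: "map_pmf (map f) (replicate_pmf N S) = replicate_pmf N (map_pmf f S)"
proof (induction N)
  case (Suc N)
  show ?case
    by (simp add: Suc.IH[symmetric]) (simp add: map_pmf_def bind_assoc_pmf bind_return_pmf)
qed simp

text \<open>The events that the single samples map \<open>v\<close> to \<open>w\<close> are
  independent with equal probability, and the count is the number of those that occur.\<close>

lemma hits_binomial:
  "map_pmf (\<lambda>X. hits X v w) (replicate_pmf N S) =
     binomial_pmf N (measure_pmf.prob S {\<phi>. \<phi> v = w})"
proof -
  let ?p = "measure_pmf.prob S {\<phi>. \<phi> v = w}"
  have p: "0 \<le> ?p" "?p \<le> 1" by auto
  have "map_pmf (\<lambda>\<phi>. \<phi> v = w) S = bernoulli_pmf ?p"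
  proof (rule pmf_eqI)
    fix b
    have "measure_pmf.prob S {\<phi>. \<phi> v \<noteq> w} = 1 - ?p"
      using measure_pmf.prob_compl[of "{\<phi>. \<phi> v = w}" S] by (simp add: Collect_neg_eq Compl_eq_Diff_UNIV)
    then show "pmf (map_pmf (\<lambda>\<phi>. \<phi> v = w) S) b = pmf (bernoulli_pmf ?p) b"
      using p by (cases b) (auto simp: pmf_map vimage_def)
  qed
  then have "binomial_pmf N ?p =
      map_pmf (length \<circ> filter id) (map_pmf (map (\<lambda>\<phi>. \<phi> v = w)) (replicate_pmf N S))"
    using p by (simp add: binomial_pmf_altdef map_replicate_pmf)
  also have "\<dots> = map_pmf (\<lambda>X. hits X v w) (replicate_pmf N S)"
    by (simp add: map_pmf_comp hits_def filter_map o_def)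
  finally show ?thesis by simp
qed

lemma prob_hits_deviate:
  assumes "0 < N" "0 < \<epsilon>"
  shows "measure_pmf.prob (replicate_pmf N S)
      {X. \<epsilon> \<le> \<bar>real (hits X v w) - N * measure_pmf.prob S {\<phi>. \<phi> v = w}\<bar>} \<le> N / \<epsilon>\<^sup>2"
proof -
  define p where "p = measure_pmf.prob S {\<phi>. \<phi> v = w}"
  interpret binomial_distribution N p by unfold_locales (auto simp: p_def)
  have "measure_pmf.prob (replicate_pmf N S) {X. \<epsilon> \<le> \<bar>real (hits X v w) - N * p\<bar>} =
      measure_pmf.prob (binomial_pmf N p) {x. \<epsilon> \<le> \<bar>real x - N * p\<bar>}"
    unfolding p_def hits_binomial[symmetric] by (simp add: vimage_def)
  also have "\<dots> \<le> 2 * exp (-2 * \<epsilon>\<^sup>2 / N)" using prob_abs_ge[OF assms(1)] assms(2) by simp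
  \<comment> \<open>The estimate exp (-x) <= 1 / x weakens Hoeffding's exponential tail to a
    rational bound, which suffices for an error polynomial in 1 / n.\<close>
  also have "\<dots> \<le> 2 * (N / (2 * \<epsilon>\<^sup>2))"
  proof -
    define x where "x = 2 * \<epsilon>\<^sup>2 / N"
    have x: "0 < x" using assms by (simp add: x_def)
    have "x \<le> exp x" using exp_ge_add_one_self[of x] by linarith
    then have "exp (-x) \<le> 1 / x" using x by (simp add: exp_minus field_simps)
    then show ?thesis by (simp add: x_def)
  qed
  finally show ?thesis by (simp add: p_def)
qed

text \<open>Conjugation by \<psi> preserves the distribution, and the conjugate of \<phi> maps
  \<open>v\<close> to \<open>w\<close> exactly if \<phi> maps \<open>\<psi> v\<close> to
  \<open>\<psi> w\<close>.\<close>

lemma prob_sampler_invariant: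
  assumes S: "invariant_automorphism_sampler G S" and \<psi>: "\<psi> \<in> Aut G"
  shows "measure_pmf.prob S {\<phi>. \<phi> (\<psi> v) = \<psi> w} = measure_pmf.prob S {\<phi>. \<phi> v = w}"
proof -
  have p: "\<psi> permutes pverts G" using \<psi> by (rule Aut_permutes)
  have [simp]: "\<psi> (inv \<psi> x) = x" "inv \<psi> (\<psi> x) = x" for x using permutes_inverses[OF p] by auto
  have inj: "inj (\<lambda>\<phi>. inv \<psi> \<circ> \<phi> \<circ> \<psi>)"
  proof (rule injI)
    fix \<phi> \<phi>' assume eq: "inv \<psi> \<circ> \<phi> \<circ> \<psi> = inv \<psi> \<circ> \<phi>' \<circ> \<psi>"
    show "\<phi> = \<phi>'"
    proof
      fix x
      have "\<psi> (inv \<psi> (\<phi> (\<psi> (inv \<psi> x)))) = \<psi> (inv \<psi> (\<phi>' (\<psi> (inv \<psi> x))))"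
        using fun_cong[OF eq, of "inv \<psi> x"] by simp
      then show "\<phi> x = \<phi>' x" by simp
    qed
  qed
  have supp: "set_pmf S \<subseteq> Aut G - {id}" and
    eq: "\<And>\<phi> \<theta>. \<phi> \<in> Aut G - {id} \<Longrightarrow> \<theta> \<in> Aut G \<Longrightarrow> pmf S (inv \<theta> \<circ> \<phi> \<circ> \<theta>) = pmf S \<phi>"
    using S by (auto simp: invariant_automorphism_sampler_def sampler_over_def)
  have conj: "inv \<psi> \<circ> (\<psi> \<circ> \<phi> \<circ> inv \<psi>) \<circ> \<psi> = \<phi>" for \<phi> by auto
  have "map_pmf (\<lambda>\<phi>. inv \<psi> \<circ> \<phi> \<circ> \<psi>) S = S"
  proof (rule pmf_eqI)
    fix \<phi>
    have "pmf (map_pmf (\<lambda>\<phi>. inv \<psi> \<circ> \<phi> \<circ> \<psi>) S) (inv \<psi> \<circ> (\<psi> \<circ> \<phi> \<circ> inv \<psi>) \<circ> \<psi>) = pmf S (\<psi> \<circ> \<phi> \<circ> inv \<psi>)"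
      by (rule pmf_map_inj') (rule inj)
    also have "\<dots> = pmf S \<phi>"
    proof (cases "\<psi> \<circ> \<phi> \<circ> inv \<psi> \<in> Aut G - {id}")
      case True
      from eq[OF this \<psi>] show ?thesis unfolding conj by simp
    next
      \<comment> \<open>Outside the nonidentity automorphisms both probabilities vanish, because
        conjugation preserves that set.\<close>
      case False
      have "\<phi> \<notin> Aut G - {id}"
      proof
        assume \<phi>: "\<phi> \<in> Aut G - {id}"
        then have "\<psi> \<circ> \<phi> \<circ> inv \<psi> \<in> Aut G" using \<psi> by (auto intro: comp_Aut inv_Aut)
        then have "\<psi> \<circ> \<phi> \<circ> inv \<psi> = id" using False by blast
        then have "\<phi> = inv \<psi> \<circ> id \<circ> \<psi>" using conj[of \<phi>] by simp
        also have "\<dots> = id" by auto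
        finally show False using \<phi> by simp
      qed
      then show ?thesis using False supp by (metis pmf_eq_0_set_pmf subsetD)
    qed
    finally show "pmf (map_pmf (\<lambda>\<phi>. inv \<psi> \<circ> \<phi> \<circ> \<psi>) S) \<phi> = pmf S \<phi>" unfolding conj .
  qed
  then have "measure_pmf.prob S {\<phi>. \<phi> v = w} =
      measure_pmf.prob (map_pmf (\<lambda>\<phi>. inv \<psi> \<circ> \<phi> \<circ> \<psi>) S) {\<phi>. \<phi> v = w}" by simp
  also have "\<dots> = measure_pmf.prob S {\<phi>. inv \<psi> (\<phi> (\<psi> v)) = w}" by (simp add: vimage_def)
  also have "{\<phi>. inv \<psi> (\<phi> (\<psi> v)) = w} = {\<phi>. \<phi> (\<psi> v) = \<psi> w}"
  proof -
    have "inv \<psi> y = w \<longleftrightarrow> y = \<psi> w" for y by (metis \<open>\<And>x. \<psi> (inv \<psi> x) = x\<close> \<open>\<And>x. inv \<psi> (\<psi> x) = x\<close>)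
    then show ?thesis by simp
  qed
  finally show ?thesis by simp
qed

text \<open>Union bound over the \<open>n ^ 2\<close> pairs: a failure of balance forces some count
  to be at least \<open>D / 2\<close> away from its mean.\<close>

lemma prob_unbalanced:
  assumes S: "invariant_automorphism_sampler G S" and G: "input_graph G"
    and n: "n = card (pverts G)" "2 \<le> n"
  shows "measure_pmf.prob (replicate_pmf (n ^ (c + 14)) S) {X. \<not> balanced G (n ^ (c + 9)) X}
    \<le> 1 / real n ^ c"
proof -
  have V: "pverts G = {..<n}" using G n by (simp add: input_graph_def)
  define N where "N = n ^ (c + 14)"
  define D where "D = n ^ (c + 9)"
  define p where "p v w = measure_pmf.prob S {\<phi>. \<phi> v = w}" for v w
  let ?M = "replicate_pmf N S"
  let ?B = "\<lambda>(v, w). {X. real D / 2 \<le> \<bar>real (hits X v w) - N * p v w\<bar>}"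
  have ND: "0 < N" "0 < D" using n by (auto simp: N_def D_def)
  have "{X. \<not> balanced G D X} \<subseteq> (\<Union>e\<in>{..<n} \<times> {..<n}. ?B e)"
  proof
    fix X assume "X \<in> {X. \<not> balanced G D X}"
    then obtain \<psi> v w where \<psi>: "\<psi> \<in> Aut G" and vw: "v < n" "w < n"
      and h: "hits X (\<psi> v) (\<psi> w) + D \<le> hits X v w"
      unfolding balanced_def V by (auto simp: not_less)
    have \<psi>n: "\<psi> v < n" "\<psi> w < n" using permutes_in_image[OF Aut_permutes[OF \<psi>]] vw V by auto
    have peq: "p (\<psi> v) (\<psi> w) = p v w" unfolding p_def by (rule prob_sampler_invariant[OF S \<psi>])
    have h': "real (hits X (\<psi> v) (\<psi> w)) + real D \<le> real (hits X v w)"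
      using h by (metis of_nat_add of_nat_le_iff)
    \<comment> \<open>Both counts have the mean \<open>N * p v w\<close>; if each were closer to it
      than \<open>D / 2\<close>, they would differ by less than \<open>D\<close>.\<close>
    have "X \<in> ?B (v, w) \<or> X \<in> ?B (\<psi> v, \<psi> w)"
    proof (rule ccontr)
      assume "\<not> ?thesis"
      then have "\<bar>real (hits X v w) - N * p v w\<bar> < D / 2"
        "\<bar>real (hits X (\<psi> v) (\<psi> w)) - N * p v w\<bar> < D / 2" by (auto simp: peq)
      then show False using h' by linarith
    qed
    then show "X \<in> (\<Union>e\<in>{..<n} \<times> {..<n}. ?B e)" using vw \<psi>n by blast
  qed
  then have "measure_pmf.prob ?M {X. \<not> balanced G D X} \<le>
      measure_pmf.prob ?M (\<Union>e\<in>{..<n} \<times> {..<n}. ?B e)"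
    by (intro measure_pmf.finite_measure_mono) auto
  also have "\<dots> \<le> (\<Sum>e\<in>{..<n} \<times> {..<n}. measure_pmf.prob ?M (?B e))"
    by (intro measure_pmf.finite_measure_subadditive_finite) auto
  also have "\<dots> \<le> (\<Sum>e\<in>{..<n} \<times> {..<n}. N / (D / 2)\<^sup>2)"
  proof (rule sum_mono)
    fix e :: "nat \<times> nat"
    obtain v w where e: "e = (v, w)" by fastforce
    show "measure_pmf.prob ?M (?B e) \<le> N / (D / 2)\<^sup>2"
      unfolding e prod.case p_def using ND by (intro prob_hits_deviate) auto
  qed
  also have "\<dots> = 4 * real n ^ 2 * N / D ^ 2"
    by (simp add: power2_eq_square field_simps)
  \<comment> \<open>The exponents give 2 + (c + 14) - 2 (c + 9) = -(c + 2); the spare factor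
    \<open>n ^ 2\<close> is at least 4 and absorbs the constant.\<close>
  also have "\<dots> = 4 / (real n ^ 2 * real n ^ c)"
  proof -
    have "real n ^ 2 * N * (real n ^ 2 * real n ^ c) = real n ^ (2 + (c + 14) + (2 + c))"
      by (simp only: N_def of_nat_power of_nat_mult power_add)
    also have "2 + (c + 14) + (2 + c) = (c + 9) * 2" by simp
    also have "real n ^ ((c + 9) * 2) = real D ^ 2" by (simp only: D_def of_nat_power power_mult)
    finally show ?thesis using n ND by (simp add: field_simps)
  qed
  also have "\<dots> \<le> 4 / (2 ^ 2 * real n ^ c)"
    using n by (intro divide_left_mono mult_right_mono power_mono mult_pos_pos) auto
  also have "\<dots> = 1 / real n ^ c" by simp
  finally show ?thesis by (simp add: N_def D_def)
qed

text \<open>The support of the sampler is nonempty and so yields a nonidentity automorphism, which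
  is impossible on fewer than two vertices.\<close>

lemma sampler_order_ge_2:
  assumes "input_graph G" "invariant_automorphism_sampler G S"
  shows "2 \<le> card (pverts G)"
proof (rule ccontr)
  assume "\<not> ?thesis"
  then have "{..<card (pverts G)} \<subseteq> {0}" by auto
  moreover have "pverts G = {..<card (pverts G)}" using assms by (simp add: input_graph_def)
  ultimately have sub: "pverts G \<subseteq> {0}" by (rule ord_eq_le_trans[rotated])
  obtain \<phi> where \<phi>: "\<phi> \<in> set_pmf S" using set_pmf_not_empty by fast
  have "set_pmf S \<subseteq> Aut G - {id}"
    using assms(2) by (simp add: invariant_automorphism_sampler_def sampler_over_def)
  then have "\<phi> \<in> Aut G" "\<phi> \<noteq> id" using \<phi> by blast+
  moreover have "\<phi> permutes {0}" using permutes_subset[OF Aut_permutes sub] \<open>\<phi> \<in> Aut G\<close> by blast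
  ultimately show False by (simp add: permutes_sing)
qed

theorem theorem9:
  fixes c :: nat
  shows "\<exists>(prog :: com) (p :: nat poly).
    \<forall>(G :: nat pair_pre_digraph) (S :: (nat \<Rightarrow> nat) pmf).
      input_graph G \<longrightarrow> invariant_automorphism_sampler G S \<longrightarrow>
      (let n = card (pverts G);
           R = run S (poly p n) ([prog], init_state G)
       in (\<forall>cfg\<in>set_pmf R. halted cfg) \<and>
          measure_pmf.prob R
            {cfg. \<not> correct_output G (output_partition (pverts G) (snd cfg))
                                    (output_certificate_set (pverts G) (snd cfg))}
          \<le> 1 / real n ^ c)"
proof -
  \<comment> \<open>The ratio \<open>n ^ 5\<close> of sample number to gap width guarantees a
    frequent pair; the size of the exponents brings the error down to
    \<open>1 / n ^ c\<close>.\<close>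
  define P where "P = partition_prog (c + 9) (c + 14)"
  obtain q where q: "\<And>n. cost n P = poly q n" using cost_poly by blast
  have *: "(\<forall>cfg\<in>set_pmf (run S (poly q n) ([compile P], init_state G)). halted cfg) \<and>
      measure_pmf.prob (run S (poly q n) ([compile P], init_state G))
        {cfg. \<not> correct_output G (output_partition (pverts G) (snd cfg))
                                (output_certificate_set (pverts G) (snd cfg))} \<le> 1 / real n ^ c"
    if G: "input_graph G" and S: "invariant_automorphism_sampler G S" and n: "n = card (pverts G)"
    for G S n
  proof -
    let ?M = "replicate_pmf (n ^ (c + 14)) S"
    let ?f = "\<lambda>X. snd (sem P (X, init_state G))"
    let ?bad = "{cfg. \<not> correct_output G (output_partition (pverts G) (snd cfg))
                                (output_certificate_set (pverts G) (snd cfg))}"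
    have n2: "2 \<le> n" using sampler_order_ge_2[OF G S] n by simp
    \<comment> \<open>The time bound holds for every outcome, so only correctness is subject to
      error, not halting.\<close>
    have run: "run S (poly q n) ([compile P], init_state G) = map_pmf (\<lambda>X. ([], ?f X)) ?M"
      using run_compile[of P "init_state G" n "poly q n" S]
      by (simp add: P_def wf_partition_prog samples_partition_prog init_state_def n flip: q)
    have "measure_pmf.prob (map_pmf (\<lambda>X. ([] :: com list, ?f X)) ?M) ?bad =
        measure_pmf.prob ?M {X. ([] :: com list, ?f X) \<in> ?bad}"
      by (simp add: vimage_def)
    \<comment> \<open>On the support, lists have the right length and consist of nonidentity
      automorphisms, as the deterministic part assumes.\<close>
    also have "\<dots> = measure_pmf.prob ?M ({X. ([] :: com list, ?f X) \<in> ?bad} \<inter> set_pmf ?M)"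
      by (simp add: measure_Int_set_pmf)
    also have "\<dots> \<le> measure_pmf.prob ?M {X. \<not> balanced G (n ^ (c + 9)) X}"
    proof (intro measure_pmf.finite_measure_mono subsetI)
      fix X assume X: "X \<in> {X. ([] :: com list, ?f X) \<in> ?bad} \<inter> set_pmf ?M"
      have e: "c + 9 + 5 = c + 14" by simp
      have "X \<in> set_pmf ?M" using X by blast
      then have "length X = n ^ (c + 14)" "set X \<subseteq> set_pmf S" unfolding set_replicate_pmf by auto
      moreover have "set_pmf S \<subseteq> Aut G - {id}"
        using S by (simp add: invariant_automorphism_sampler_def sampler_over_def)
      ultimately show "X \<in> {X. \<not> balanced G (n ^ (c + 9)) X}"
        using partition_prog_correct[OF G n n2, of X "c + 9" "?f X", unfolded e] X
        unfolding P_def by fastforce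
    qed auto
    also have "\<dots> \<le> 1 / real n ^ c" by (rule prob_unbalanced[OF S G n n2])
    finally show ?thesis unfolding run by (auto simp: halted_def)
  qed
  show ?thesis
    unfolding Let_def by (intro exI[of _ "compile P"] exI[of _ q] allI impI) (rule *[OF _ _ refl])
qed

end
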